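(* Let $X$ be a Lévy process with $\int_{\mathbb{R}\setminus\{0\}}(x^2\wedge|x|)K_0(dx)<\infty$, and let $\alpha_0=\inf\{\alpha>0\,|\,\Phi(\alpha)\le 0\}$, with $\inf\{\emptyset\}=+\infty$. Then, for integer $n$, ${\bf E}(I_\infty^n)<\infty$ if and only if $1\le n<\alpha_0$. In particular, for Brownian motion with drift coefficient $b_0$ and diffusion coefficient $c_0\ne 0$, $$\Phi(n)=nb_0-\tfrac12n^2c_0,$$ and the moment of $I_\infty$ of order $n\ge 1$ exists if $n<\frac{2b_0}{c_0}$. If $X$ is a subordinator with non-zero Lévy measure $K_0$ such that $\int_{\mathbb{R}\setminus\{0\}}(|x|\wedge 1)K_0(dx)<\infty$, then $$\Phi(n)=n\Big[b_0-\int_{\mathbb{R}^+\setminus\{0\}}xK_0(dx)\Big]-\int_{\mathbb{R}^+\setminus\{0\}}(e^{-nx}-1)K_0(dx),$$ and under the condition $b_0-\int_{\mathbb{R}^+\setminus\{0\}}xK_0(dx)\ge 0$ all moments of $I_\infty$ exist.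
   Context: $X=(X_t)_{t\ge 0}$ is a real-valued Lévy process, $X_0=0$, with parameters $(b_0,c_0,K_0)$ (drift written without truncation of jumps, Gaussian variance $c_0$ per unit time, Lévy measure $K_0$). Its Laplace exponent is given by ${\bf E}(e^{-\alpha X_t})=e^{-t\Phi(\alpha)}$, $$\Phi(\alpha)=\alpha b_0-\tfrac12\alpha^2c_0-\int_{\mathbb{R}\setminus\{0\}}(e^{-\alpha x}-1+\alpha x)K_0(dx)$$ (the integrand is nonnegative, so $\Phi(\alpha)=-\infty$ when the integral diverges). $I_\infty=\int_0^\infty e^{-X_s}ds$. Brownian motion with drift coefficient $b_0$ and diffusion coefficient $c_0$ is the Lévy process with parameters $(b_0,c_0,0)$.
   Formalization: The equivalence is stated for integers n ≥ 1 and excludes the case n = α₀ with Φ(n) > 0 (Φ = −∞ beyond n), where the n-th moment is finite although n < α₀ fails; for n = 0 the literal equivalence is false too. *)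

theory Defs
  imports "HOL-Probability.Probability"
begin

definition cadlag :: "(real \<Rightarrow> real) \<Rightarrow> bool" where
  "cadlag f \<longleftrightarrow> (\<forall>t\<ge>0. continuous (at_right t) f) \<and>
     (\<forall>t>0. \<exists>l. (f \<longlongrightarrow> l) (at_left t))"

locale levy_process = prob_space M
  for M :: "'a measure" and X :: "real \<Rightarrow> 'a \<Rightarrow> real" +
  assumes random_variable_X: "\<And>t. 0 \<le> t \<Longrightarrow> X t \<in> borel_measurable M"
    and starts_at_0: "AE \<omega> in M. X 0 \<omega> = 0"
    and cadlag_paths: "AE \<omega> in M. cadlag (\<lambda>t. X t \<omega>)"
    and indep_increments:
      "\<And>(\<tau> :: nat \<Rightarrow> real) n. 0 \<le> \<tau> 0 \<Longrightarrow> (\<And>i. i < n \<Longrightarrow> \<tau> i \<le> \<tau> (Suc i)) \<Longrightarrow>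
         indep_vars (\<lambda>_. borel) (\<lambda>i \<omega>. X (\<tau> (Suc i)) \<omega> - X (\<tau> i) \<omega>) {..<n}"
    and stationary_increments:
      "\<And>s h. 0 \<le> s \<Longrightarrow> 0 \<le> h \<Longrightarrow>
         distr M borel (\<lambda>\<omega>. X (s + h) \<omega> - X s \<omega>) = distr M borel (X h)"

text \<open>A measure on the reals without the origin is encoded as a Borel measure on the reals
  that does not charge the origin.\<close>

definition levy_measure :: "real measure \<Rightarrow> bool" where
  "levy_measure K \<longleftrightarrow> sets K = sets borel \<and> emeasure K {0} = 0 \<and>
     (\<integral>\<^sup>+x\<in>- {0}. ennreal (min (x\<^sup>2) 1) \<partial>K) < \<infinity>"

text \<open>The Levy-Khintchine exponent without truncation of the jumps. It is meaningful only if
  \<open>min (x\<^sup>2) \<bar>x\<bar>\<close> is integrable with respect to \<open>K\<close>, because otherwise the Bochner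
  integral may have the default value 0.\<close>

definition levy_khintchine_exponent :: "real \<Rightarrow> real \<Rightarrow> real measure \<Rightarrow> real \<Rightarrow> complex" where
  "levy_khintchine_exponent b c K u =
     \<i> * of_real (u * b) - of_real (u\<^sup>2 * c / 2) +
     (CLINT x:(- {0})|K. (iexp (u * x) - 1 - \<i> * of_real (u * x)))"

locale levy_process_with_parameters = levy_process M X
  for M :: "'a measure" and X :: "real \<Rightarrow> 'a \<Rightarrow> real" +
  fixes b0 c0 :: real and K0 :: "real measure"
  assumes c0_nonneg: "0 \<le> c0"
    and levy_measure_K0: "levy_measure K0"
    and levy_khintchine:
      "\<And>t u. 0 \<le> t \<Longrightarrow>
         char (distr M borel (X t)) u = exp (of_real t * levy_khintchine_exponent b0 c0 K0 u)"

definition subordinator :: "'a measure \<Rightarrow> (real \<Rightarrow> 'a \<Rightarrow> real) \<Rightarrow> bool" where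
  "subordinator M X \<longleftrightarrow> levy_process M X \<and> (AE \<omega> in M. mono_on {0..} (\<lambda>t. X t \<omega>))"

text \<open>The integrand is nonnegative, so the value is \<open>-\<infinity>\<close> exactly when the integral
  diverges.\<close>

definition laplace_exponent :: "real \<Rightarrow> real \<Rightarrow> real measure \<Rightarrow> real \<Rightarrow> ereal" where
  "laplace_exponent b c K \<alpha> =
     ereal (\<alpha> * b - \<alpha>\<^sup>2 * c / 2) -
     enn2ereal (\<integral>\<^sup>+x\<in>- {0}. ennreal (exp (- \<alpha> * x) - 1 + \<alpha> * x) \<partial>K)"

definition alpha0 :: "real \<Rightarrow> real \<Rightarrow> real measure \<Rightarrow> ereal" where
  "alpha0 b c K = Inf {ereal \<alpha> |\<alpha>. 0 < \<alpha> \<and> laplace_exponent b c K \<alpha> \<le> 0}"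

definition exp_functional :: "(real \<Rightarrow> 'a \<Rightarrow> real) \<Rightarrow> 'a \<Rightarrow> ennreal" where
  "exp_functional X \<omega> = (\<integral>\<^sup>+s\<in>{0..}. ennreal (exp (- X s \<omega>)) \<partial>lborel)"

definition exp_functional_moment :: "'a measure \<Rightarrow> (real \<Rightarrow> 'a \<Rightarrow> real) \<Rightarrow> nat \<Rightarrow> ennreal" where
  "exp_functional_moment M X n = (\<integral>\<^sup>+\<omega>. exp_functional X \<omega> ^ n \<partial>M)"

end

theory Submission
  imports Defs
begin

text \<open>The \<open>n\<close>-th power of \<open>\<integral> exp (- X s) ds\<close> is \<open>n!\<close> times an integral over the ordered simplex, where
  the integrand is a product of independent increments; hence the \<open>n\<close>-th moment equals
  \<open>n!\<close> times the product over \<open>k = 1, \<dots>, n\<close> of \<open>\<integral> E (exp (- k X h)) dh\<close>. Since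
  \<open>E (exp (- k X h)) = exp (- h \<Phi> k)\<close>, the \<open>k\<close>-th factor is finite exactly if \<open>\<Phi> k > 0\<close>, and by
  concavity of \<open>\<Phi>\<close> it suffices that \<open>\<Phi> n > 0\<close>. The formula for \<open>E (exp (- \<alpha> X h))\<close>, infinite
  values included, is obtained from the characteristic function by approximating the law of \<open>X h\<close>
  weakly by convolutions of a normal law with compound Poisson laws.\<close>


subsection \<open>Compound Poisson laws\<close>

text \<open>The hypothesis on \<open>X\<close> speaks of characteristic functions only, whereas the
  moments belong to imaginary arguments, where the exponent may diverge; an infinite exponential
  moment rules out analytic continuation and still has to be proved infinite. Hence the detour over
  laws whose exponential moments are explicit. Weak convergence by itself yields only one
  inequality, so the jumps are separated. For a \<ge> 0 the function exp (- a x) is bounded on x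
  \<ge> - 1, so the jumps there, cut off near 0 where the Levy measure may have infinite mass, have
  controlled exponential moments. The jumps below - 1 have finite total mass, form a factor common
  to all approximating laws, and alone decide whether the moment is finite. The moments of the
  functional are computed in \<open>ennreal\<close>, so Tonelli and the product formula for
  independent factors apply without integrability, and infinite values are covered. The price is
  joint measurability in time and \<omega>, which comes from right-continuity of the paths.\<close>

lemma real_distribution_convolution:
  assumes "real_distribution A" "real_distribution B"
  shows "real_distribution (A \<star> B)"
proof -
  interpret A: real_distribution A by fact
  interpret B: real_distribution B by fact
  interpret pair_prob_space A B ..
  have "random_variable borel (\<lambda>(x, y). x + y)"
    by (simp add: measurable_cong_sets[OF sets_pair_measure_cong[OF A.events_eq_borel B.events_eq_borel]])
  then show ?thesis
    unfolding convolution_def by (rule real_distribution_distr)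
qed

lemma char_convolution:
  assumes "real_distribution A" "real_distribution B"
  shows "char (A \<star> B) u = char A u * char B u"
proof -
  interpret A: real_distribution A by fact
  interpret B: real_distribution B by fact
  interpret pair_prob_space A B ..
  have [measurable_cong]: "sets A = sets borel" "sets B = sets borel"
    by auto
  have "char (A \<star> B) u = (CLINT z|A \<Otimes>\<^sub>M B. iexp (u * (fst z + snd z)))"
    unfolding char_def convolution_def by (subst integral_distr) (auto simp: split_beta)
  also have "\<dots> = (CLINT x|A. CLINT y|B. iexp (u * x) * iexp (u * y))"
    by (subst integral_fst'[symmetric])
       (auto intro!: P.integrable_const_bound[where B=1] simp: distrib_left exp_add norm_mult)
  also have "\<dots> = char A u * char B u"
    by (simp add: char_def mult.commute)
  finally show ?thesis .
qed

lemma nn_integral_exp_convolution: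
  assumes "real_distribution A" "real_distribution B"
  shows "(\<integral>\<^sup>+x. ennreal (exp (r * x)) \<partial>(A \<star> B)) =
    (\<integral>\<^sup>+x. ennreal (exp (r * x)) \<partial>A) * (\<integral>\<^sup>+x. ennreal (exp (r * x)) \<partial>B)"
proof -
  interpret A: real_distribution A by fact
  interpret B: real_distribution B by fact
  have [measurable_cong]: "sets A = sets borel" "sets B = sets borel"
    by auto
  show ?thesis
    by (subst nn_integral_convolution)
       (auto simp: A.finite_measure_axioms B.finite_measure_axioms distrib_left exp_add
         ennreal_mult nn_integral_cmult nn_integral_multc)
qed

section \<open>Random sums: convolution powers and Poisson mixtures\<close>

fun convolution_power :: "real measure \<Rightarrow> nat \<Rightarrow> real measure" where
  "convolution_power N 0 = return borel 0"
| "convolution_power N (Suc k) = (N \<star> convolution_power N k)"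

lemma real_distribution_return: "real_distribution (return borel a)"
  by (intro real_distribution.intro real_distribution_axioms.intro prob_space_return) auto

lemma char_return: "char (return borel a) u = iexp (u * a)"
  unfolding char_def by (subst integral_return) auto

lemma nn_integral_exp_return:
  "(\<integral>\<^sup>+x. ennreal (exp (r * x)) \<partial>return borel a) = ennreal (exp (r * a))" for a :: real
  by (subst nn_integral_return) auto

lemma real_distribution_convolution_power:
  "real_distribution N \<Longrightarrow> real_distribution (convolution_power N k)"
  by (induction k) (auto intro: real_distribution_convolution real_distribution_return)

lemma char_convolution_power:
  "real_distribution N \<Longrightarrow> char (convolution_power N k) u = char N u ^ k"
  by (induction k)
     (auto simp: char_return char_convolution real_distribution_convolution_power)

lemma nn_integral_exp_convolution_power:
  "real_distribution N \<Longrightarrow> (\<integral>\<^sup>+x. ennreal (exp (r * x)) \<partial>convolution_power N k) =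
    (\<integral>\<^sup>+x. ennreal (exp (r * x)) \<partial>N) ^ k"
  by (induction k)
     (auto simp: nn_integral_exp_return nn_integral_exp_convolution real_distribution_convolution_power)

text \<open>Real and imaginary part are treated separately by \<open>integral_bind\<close>; the
  bound \<open>B\<close> makes all the integrals converge. Applied to \<open>iexp\<close>, this
  gives the characteristic function of a mixture.\<close>

lemma integral_bind_complex:
  fixes f :: "'a \<Rightarrow> complex"
  assumes f [measurable]: "f \<in> borel_measurable K"
    and bounded: "\<And>x. norm (f x) \<le> B"
    and N: "N \<in> M \<rightarrow>\<^sub>M prob_algebra K" and M: "prob_space M"
  shows "integral\<^sup>L (M \<bind> N) f = (\<integral>x. integral\<^sup>L (N x) f \<partial>M)"
proof -
  interpret M: prob_space M by fact
  have N': "N \<in> M \<rightarrow>\<^sub>M subprob_algebra K"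
    using N by (rule measurable_prob_algebraD)
  have prob: "prob_space (N x)" "sets (N x) = sets K" if "x \<in> space M" for x
    using measurable_space[OF N that] by (auto simp: space_prob_algebra)
  have bind: "prob_space (M \<bind> N)"
    using prob by (intro M.prob_space_bind[OF _ N']) auto
  have sets_bind: "sets (M \<bind> N) = sets K"
    by (rule sets_bind[OF _ M.not_empty]) (use prob in auto)
  have B: "\<bar>Re (f x)\<bar> \<le> B" "\<bar>Im (f x)\<bar> \<le> B" for x
    using bounded[of x] abs_Re_le_cmod[of "f x"] abs_Im_le_cmod[of "f x"] by auto
  have emeas: "AE x in M. emeasure (N x) (space (N x)) \<le> ennreal 1"
    using prob by (auto intro!: AE_I2 simp: prob_space.emeasure_space_1)
  have int: "integrable Q f" if "prob_space Q" "sets Q = sets K" for Q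
    using that bounded
    by (intro finite_measure.integrable_const_bound[where B=B] prob_space.finite_measure)
       (auto simp: measurable_cong_sets[OF that(2) refl])
  have *: "f \<in> borel_measurable (M \<bind> N)" and **: "\<And>x. x \<in> space M \<Longrightarrow> integrable (N x) f"
    using int prob sets_bind by (auto simp: measurable_cong_sets[OF sets_bind refl])
  have meas: "(\<lambda>x. integral\<^sup>L (N x) g) \<in> borel_measurable M" if "g \<in> borel_measurable K" for g :: "'a \<Rightarrow> complex"
    using integral_measurable_subprob_algebra[OF that] N' by (rule measurable_compose[rotated])
  have int': "integrable M (\<lambda>x. integral\<^sup>L (N x) f)"
  proof (rule M.integrable_const_bound[where B=B])
    show "AE x in M. norm (integral\<^sup>L (N x) f) \<le> B"
    proof (rule AE_I2)
      fix x assume x: "x \<in> space M"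
      interpret Nx: prob_space "N x" by (rule prob(1)[OF x])
      have "norm (integral\<^sup>L (N x) f) \<le> (\<integral>y. norm (f y) \<partial>N x)"
        by (rule integral_norm_bound)
      also have "\<dots> \<le> B"
        using bounded **[OF x] by (intro Nx.integral_le_const) auto
      finally show "norm (integral\<^sup>L (N x) f) \<le> B" .
    qed
  qed (rule meas[OF f])
  show ?thesis
  proof (rule complex_eqI)
    have "Re (integral\<^sup>L (M \<bind> N) f) = integral\<^sup>L (M \<bind> N) (\<lambda>x. Re (f x))"
      using int[OF bind sets_bind] by (rule integral_Re[symmetric])
    also have "\<dots> = (\<integral>x. integral\<^sup>L (N x) (\<lambda>x. Re (f x)) \<partial>M)"
      by (rule integral_bind[OF _ _ N' M.finite_measure_axioms emeas]) (use B in auto)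
    also have "\<dots> = (\<integral>x. Re (integral\<^sup>L (N x) f) \<partial>M)"
      by (intro Bochner_Integration.integral_cong refl integral_Re **)
    also have "\<dots> = Re (\<integral>x. integral\<^sup>L (N x) f \<partial>M)"
      using int' by (rule integral_Re)
    finally show "Re (integral\<^sup>L (M \<bind> N) f) = Re (\<integral>x. integral\<^sup>L (N x) f \<partial>M)" .
    have "Im (integral\<^sup>L (M \<bind> N) f) = integral\<^sup>L (M \<bind> N) (\<lambda>x. Im (f x))"
      using int[OF bind sets_bind] by (rule integral_Im[symmetric])
    also have "\<dots> = (\<integral>x. integral\<^sup>L (N x) (\<lambda>x. Im (f x)) \<partial>M)"
      by (rule integral_bind[OF _ _ N' M.finite_measure_axioms emeas]) (use B in auto)
    also have "\<dots> = (\<integral>x. Im (integral\<^sup>L (N x) f) \<partial>M)"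
      by (intro Bochner_Integration.integral_cong refl integral_Im **)
    also have "\<dots> = Im (\<integral>x. integral\<^sup>L (N x) f \<partial>M)"
      using int' by (rule integral_Im)
    finally show "Im (integral\<^sup>L (M \<bind> N) f) = Im (\<integral>x. integral\<^sup>L (N x) f \<partial>M)" .
  qed
qed

text \<open>This is the generating function of the Poisson law on the closed unit disc, which
  contains every value of a characteristic function. There the Poisson weights dominate the
  series.\<close>

lemma integral_poisson_power:
  fixes z :: complex
  assumes "0 < r" "norm z \<le> 1"
  shows "(\<integral>k. z ^ k \<partial>measure_pmf (poisson_pmf r)) = exp (of_real r * (z - 1))"
proof -
  have sums: "(\<lambda>k. (r ^ k / fact k * exp (-r)) *\<^sub>R z ^ k) sums (exp (of_real r * z) * of_real (exp (-r)))"
    using sums_mult2[OF exp_converges[of "of_real r * z"], of "of_real (exp (-r))"]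
    by (simp add: scaleR_conv_of_real power_mult_distrib field_simps)
  have int: "integrable (count_space UNIV) (\<lambda>k. (r ^ k / fact k * exp (-r)) *\<^sub>R z ^ k)"
  proof (subst integrable_count_space_nat_iff, rule summable_comparison_test)
    show "summable (\<lambda>k. r ^ k / fact k * exp (- r))"
      using summable_mult2[OF summable_exp[of r], of "exp (-r)"] by (simp add: field_simps)
    show "\<exists>N. \<forall>n\<ge>N. norm (norm ((r ^ n / fact n * exp (- r)) *\<^sub>R z ^ n)) \<le> r ^ n / fact n * exp (- r)"
      using assms by (auto simp: norm_power intro!: divide_right_mono mult_left_le power_le_one)
  qed
  have "(\<integral>k. z ^ k \<partial>measure_pmf (poisson_pmf r)) =
      (\<integral>k. (r ^ k / fact k * exp (-r)) *\<^sub>R z ^ k \<partial>count_space UNIV)"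
    using assms by (simp add: measure_pmf_eq_density integral_density)
  also have "\<dots> = exp (of_real r * z) * of_real (exp (-r))"
    using sums_unique2[OF sums_integral_count_space_nat[OF int] sums] .
  also have "\<dots> = exp (of_real r * (z - 1))"
    by (simp add: exp_diff exp_minus exp_of_real[symmetric] field_simps right_diff_distrib)
  finally show ?thesis .
qed

lemma nn_integral_poisson_power:
  assumes "0 < r" "0 \<le> x"
  shows "(\<integral>\<^sup>+k. ennreal x ^ k \<partial>measure_pmf (poisson_pmf r)) = ennreal (exp (r * (x - 1)))"
proof -
  have sums: "(\<lambda>k. r ^ k / fact k * exp (-r) * x ^ k) sums (exp (r * x) * exp (-r))"
    using sums_mult2[OF exp_converges[of "r * x"], of "exp (-r)"]
    by (simp add: power_mult_distrib field_simps)
  have "(\<integral>\<^sup>+k. ennreal x ^ k \<partial>measure_pmf (poisson_pmf r)) =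
      (\<integral>\<^sup>+k. ennreal (r ^ k / fact k * exp (-r) * x ^ k) \<partial>count_space UNIV)"
    using assms by (auto simp: nn_integral_measure_pmf ennreal_power ennreal_mult[symmetric] intro!: nn_integral_cong)
  also have "\<dots> = (\<Sum>k. ennreal (r ^ k / fact k * exp (-r) * x ^ k))"
    by (rule nn_integral_count_space_nat)
  also have "\<dots> = ennreal (exp (r * x) * exp (-r))"
    using assms sums by (intro suminf_ennreal_eq) auto
  also have "exp (r * x) * exp (-r) = exp (r * (x - 1))"
    by (simp add: exp_add[symmetric] algebra_simps)
  finally show ?thesis .
qed

text \<open>The atom at 1 has positive mass and already contributes an infinite amount.\<close>

lemma nn_integral_poisson_power_top:
  assumes "0 < r"
  shows "(\<integral>\<^sup>+k. \<top> ^ k \<partial>measure_pmf (poisson_pmf r)) = (\<top> :: ennreal)"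
proof -
  have "\<top> = \<top> ^ 1 * ennreal (pmf (poisson_pmf r) 1)"
    using assms by (simp add: ennreal_top_mult)
  also have "\<dots> = (\<integral>\<^sup>+k. \<top> ^ 1 * indicator {1} k \<partial>measure_pmf (poisson_pmf r))"
    by (subst nn_integral_cmult_indicator) (auto simp: emeasure_pmf_single)
  also have "\<dots> \<le> (\<integral>\<^sup>+k. \<top> ^ k \<partial>measure_pmf (poisson_pmf r))"
    by (intro nn_integral_mono) (auto split: split_indicator)
  finally show ?thesis
    by (simp add: top_unique)
qed

text \<open>The law is that of a sum of a Poisson number, with mean the total mass \<open>l\<close>
  of \<open>N\<close>, of independent jumps with law \<open>N / l\<close>. Mass zero allows no
  normalization and gives the point mass at 0. Finite and infinite exponential moments are separate
  clauses because the Bochner integral in the exponent means nothing in the infinite case.\<close>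

lemma compound_poisson_exists:
  fixes N :: "real measure"
  assumes sets_N [measurable_cong]: "sets N = sets borel" and "finite_measure N"
  obtains P where "real_distribution P"
    and "\<And>u. char P u = exp (CLINT x|N. iexp (u * x) - 1)"
    and "\<And>r. (\<integral>\<^sup>+x. ennreal (exp (r * x)) \<partial>N) < \<infinity> \<Longrightarrow>
      (\<integral>\<^sup>+x. ennreal (exp (r * x)) \<partial>P) = ennreal (exp (LINT x|N. exp (r * x) - 1))"
    and "\<And>r. (\<integral>\<^sup>+x. ennreal (exp (r * x)) \<partial>N) = \<infinity> \<Longrightarrow> (\<integral>\<^sup>+x. ennreal (exp (r * x)) \<partial>P) = \<infinity>"
proof (cases "emeasure N (space N) = 0")
  case True
  then have N: "N = null_measure borel"
    by (intro measure_eqI)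
       (auto simp: sets_N sets_eq_imp_space_eq[OF sets_N] intro: emeasure_eq_0[of UNIV])
  show ?thesis
    by (rule that[of "return borel 0"])
       (auto simp: N real_distribution_return char_return nn_integral_exp_return)
next
  case False
  interpret N: finite_measure N by fact
  define l where "l = measure N (space N)"
  have l: "0 < l" "emeasure N (space N) = ennreal l"
    using False by (auto simp: l_def N.emeasure_eq_measure zero_less_measure_iff)
  define Q where "Q = density N (\<lambda>_. ennreal (1 / l))"
  have sets_Q [measurable_cong]: "sets Q = sets borel"
    by (simp add: Q_def sets_N)
  have Q: "real_distribution Q"
  proof (intro real_distribution.intro real_distribution_axioms.intro prob_spaceI)
    show "emeasure Q (space Q) = 1"
      using l by (simp add: Q_def emeasure_density_const ennreal_mult[symmetric])
  qed (auto simp: sets_Q sets_eq_imp_space_eq[OF sets_Q])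
  interpret Q: real_distribution Q by fact
  let ?K = "convolution_power Q"
  have K: "?K \<in> measure_pmf (poisson_pmf l) \<rightarrow>\<^sub>M prob_algebra borel"
    using real_distribution_convolution_power[OF Q]
    by (auto simp: space_prob_algebra real_distribution.axioms(1) real_distribution.events_eq_borel)
  define P where "P = measure_pmf (poisson_pmf l) \<bind> ?K"
  show ?thesis
  proof (rule that[of P])
    show "real_distribution P"
      unfolding P_def
      using prob_space.prob_space_bind[OF measure_pmf.prob_space_axioms _ measurable_prob_algebraD[OF K]]
        Giry_Monad.sets_bind[OF _ measure_pmf.not_empty, where N=borel]
        real_distribution_convolution_power[OF Q]
      by (auto intro!: real_distribution.intro real_distribution_axioms.intro
          simp: real_distribution.axioms(1) real_distribution.events_eq_borel)
    show "char P u = exp (CLINT x|N. iexp (u * x) - 1)" for u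
    proof -
      have "char P u = (\<integral>k. char (?K k) u \<partial>measure_pmf (poisson_pmf l))"
        unfolding P_def char_def
        by (rule integral_bind_complex[OF _ _ K, where B=1]) (auto simp: measure_pmf.prob_space_axioms)
      also have "\<dots> = (\<integral>k. char Q u ^ k \<partial>measure_pmf (poisson_pmf l))"
        by (simp add: char_convolution_power[OF Q])
      also have "\<dots> = exp (of_real l * (char Q u - 1))"
        using l(1) Q.cmod_char_le_1 by (rule integral_poisson_power)
      also have "of_real l * (char Q u - 1) = (CLINT x|N. iexp (u * x) - 1)"
      proof -
        have "integrable N (\<lambda>x. iexp (u * x))"
          by (rule N.integrable_const_bound[where B=1]) auto
        moreover have "char Q u = of_real (1 / l) * (CLINT x|N. iexp (u * x))"
          unfolding char_def Q_def using l
          by (subst integral_density) (auto simp: scaleR_conv_of_real)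
        ultimately show ?thesis
          using l by (simp add: l_def field_simps scaleR_conv_of_real)
      qed
      finally show ?thesis .
    qed
    have laplace: "(\<integral>\<^sup>+x. ennreal (exp (r * x)) \<partial>P) =
      (\<integral>\<^sup>+k. (\<integral>\<^sup>+x. ennreal (exp (r * x)) \<partial>Q) ^ k \<partial>measure_pmf (poisson_pmf l))" for r
      unfolding P_def
      by (subst nn_integral_bind[OF _ measurable_prob_algebraD[OF K]])
         (auto simp: nn_integral_exp_convolution_power[OF Q])
    have laplace_Q: "(\<integral>\<^sup>+x. ennreal (exp (r * x)) \<partial>Q) =
      ennreal (1 / l) * (\<integral>\<^sup>+x. ennreal (exp (r * x)) \<partial>N)" for r
      unfolding Q_def by (subst nn_integral_density) (auto simp: nn_integral_cmult)
    show "(\<integral>\<^sup>+x. ennreal (exp (r * x)) \<partial>P) = ennreal (exp (LINT x|N. exp (r * x) - 1))"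
      if "(\<integral>\<^sup>+x. ennreal (exp (r * x)) \<partial>N) < \<infinity>" for r
    proof -
      have int: "integrable N (\<lambda>x. exp (r * x))"
        using that by (intro integrableI_bounded) auto
      have eq: "(\<integral>\<^sup>+x. ennreal (exp (r * x)) \<partial>N) = ennreal (LINT x|N. exp (r * x))"
        using int by (intro nn_integral_eq_integral) auto
      have "(\<integral>\<^sup>+x. ennreal (exp (r * x)) \<partial>P) = ennreal (exp (l * ((LINT x|N. exp (r * x)) / l - 1)))"
        unfolding laplace laplace_Q eq using l
        by (subst ennreal_mult[symmetric]) (auto simp: nn_integral_poisson_power)
      also have "l * ((LINT x|N. exp (r * x)) / l - 1) = (LINT x|N. exp (r * x) - 1)"
        using int l by (simp add: l_def field_simps)
      finally show ?thesis .
    qed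
    show "(\<integral>\<^sup>+x. ennreal (exp (r * x)) \<partial>P) = \<infinity>" if "(\<integral>\<^sup>+x. ennreal (exp (r * x)) \<partial>N) = \<infinity>" for r
      unfolding laplace laplace_Q that using l
      by (simp add: ennreal_mult_top nn_integral_poisson_power_top)
  qed
qed

subsection \<open>Exponential moments of infinitely divisible laws\<close>

text \<open>Weak convergence controls bounded continuous functions only; the truncated exponentials
  are of that kind, and monotone convergence recovers the exponential.\<close>

lemma tendsto_nn_integral_exp_truncated:
  fixes r :: real
  assumes [measurable_cong]: "sets Q = sets borel"
  shows "(\<lambda>N. \<integral>\<^sup>+x. ennreal (min (exp (r * x)) (real N)) \<partial>Q) \<longlonglongrightarrow>
    (\<integral>\<^sup>+x. ennreal (exp (r * x)) \<partial>Q)"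
proof (rule nn_integral_LIMSEQ)
  show "incseq (\<lambda>N x. ennreal (min (exp (r * x)) (real N)))"
    by (auto simp: incseq_def le_fun_def intro!: ennreal_leI)
  show "(\<lambda>N. ennreal (min (exp (r * x)) (real N))) \<longlonglongrightarrow> ennreal (exp (r * x))" for x
  proof (rule tendsto_eventually)
    show "\<forall>\<^sub>F N in sequentially. ennreal (min (exp (r * x)) (real N)) = ennreal (exp (r * x))"
      using eventually_ge_at_top[of "nat \<lceil>exp (r * x)\<rceil>"]
      by eventually_elim (simp add: min_absorb1 nat_ceiling_le_eq)
  qed
qed auto

lemma nn_integral_exp_truncated_le:
  "(\<integral>\<^sup>+x. ennreal (min (exp (r * x)) N) \<partial>Q) \<le> (\<integral>\<^sup>+x. ennreal (exp (r * x)) \<partial>Q)" for r N :: real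
  by (intro nn_integral_mono ennreal_leI) auto

text \<open>Exponential moments pass to a weak limit of the laws \<open>A n \<star> B\<close>: truncation gives the upper
  bound, and for the lower bound the second moments of the \<open>A n\<close> are uniformly bounded, whereas
  the fixed factor \<open>B\<close> may have an infinite exponential moment.\<close>

lemma nn_integral_exp_weak_limit:
  fixes A :: "nat \<Rightarrow> real measure" and B L :: "real measure" and r :: real
  assumes A: "\<And>n. real_distribution (A n)" and B: "real_distribution B" and L: "real_distribution L"
    and char_lim: "\<And>u. (\<lambda>n. char (A n) u * char B u) \<longlonglongrightarrow> char L u"
    and first: "\<And>n. (\<integral>\<^sup>+x. ennreal (exp (r * x)) \<partial>A n) = ennreal (exp (e n))" "e \<longlonglongrightarrow> e0"
    and second: "\<And>n. (\<integral>\<^sup>+x. ennreal (exp (2 * r * x)) \<partial>A n) = ennreal (exp (d n))" "d \<longlonglongrightarrow> d0"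
  shows "(\<integral>\<^sup>+x. ennreal (exp (r * x)) \<partial>L) = ennreal (exp e0) * (\<integral>\<^sup>+x. ennreal (exp (r * x)) \<partial>B)"
proof -
  interpret B: real_distribution B by fact
  interpret L: real_distribution L by fact
  have AB: "real_distribution (A n \<star> B)" for n
    using A B by (rule real_distribution_convolution)
  have weak: "weak_conv_m (\<lambda>n. A n \<star> B) L"
    using char_lim by (intro levy_continuity AB L) (simp add: char_convolution[OF A B])
  have trunc_eq: "(\<integral>\<^sup>+x. ennreal (min (exp (r * x)) N) \<partial>Q) = ennreal (LINT x|Q. min (exp (r * x)) N)"
    if "real_distribution Q" "0 \<le> N" for Q N
  proof -
    interpret Q: real_distribution Q by fact
    show ?thesis
      using that(2)
      by (intro nn_integral_eq_integral Q.integrable_const_bound[where B=N]) auto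
  qed
  have trunc_lim: "(\<lambda>n. \<integral>\<^sup>+x. ennreal (min (exp (r * x)) N) \<partial>(A n \<star> B)) \<longlonglongrightarrow>
      (\<integral>\<^sup>+x. ennreal (min (exp (r * x)) N) \<partial>L)" if "0 \<le> N" for N
    unfolding trunc_eq[OF AB that] trunc_eq[OF L that] using that
    by (intro tendsto_ennrealI weak_conv_imp_integral_bdd_continuous_conv[OF AB L weak, where B=N])
       (auto intro!: continuous_intros)
  let ?LB = "\<integral>\<^sup>+x. ennreal (exp (r * x)) \<partial>B"
  have exp_lim: "(\<lambda>n. ennreal (exp (e n)) * ?LB) \<longlonglongrightarrow> ennreal (exp e0) * ?LB"
    by (intro tendsto_mult_ennreal tendsto_const tendsto_ennrealI tendsto_exp first(2)) auto
  \<comment> \<open>The order of limits matters: \<open>n\<close> tends to infinity at a fixed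
    truncation level, and only then the level is removed.\<close>
  have upper: "(\<integral>\<^sup>+x. ennreal (exp (r * x)) \<partial>L) \<le> ennreal (exp e0) * ?LB"
  proof (rule LIMSEQ_le_const2[OF tendsto_nn_integral_exp_truncated[OF L.events_eq_borel]], intro exI allI impI)
    fix N :: nat
    show "(\<integral>\<^sup>+x. ennreal (min (exp (r * x)) (real N)) \<partial>L) \<le> ennreal (exp e0) * ?LB"
    proof (rule LIMSEQ_le[OF trunc_lim exp_lim], simp, intro exI allI impI)
      fix n
      show "(\<integral>\<^sup>+x. ennreal (min (exp (r * x)) (real N)) \<partial>(A n \<star> B)) \<le> ennreal (exp (e n)) * ?LB"
        by (rule order_trans[OF nn_integral_exp_truncated_le])
           (simp add: nn_integral_exp_convolution[OF A B] first(1))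
    qed
  qed
  define V where "V s = (\<integral>\<^sup>+x. ennreal (min (exp (r * x)) (real s)) \<partial>B)" for s
  have V_lim: "V \<longlonglongrightarrow> ?LB"
    unfolding V_def by (rule tendsto_nn_integral_exp_truncated) simp
  \<comment> \<open>In \<open>lower_s\<close> the factor exp e0 - exp d0 / s may be clipped to 0 by
    \<open>ennreal\<close>, and multiplication is continuous there only if the other factor is
    finite.\<close>
  have V_fin: "V s < \<infinity>" for s
    by (simp add: V_def trunc_eq[OF B])
  \<comment> \<open>Truncating the \<open>A n\<close> factor at \<open>s\<close> loses at most exp
    (d n) / s, because exp (r x) > s implies exp (r x) \<le> exp (2 r x) / s. A negative difference
    is read as 0 by \<open>ennreal\<close>, which keeps the bound true. The square appears because a
    product of two quantities truncated at \<open>s\<close> is at most their product truncated at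
    the square of \<open>s\<close>.\<close>
  have lower_n: "ennreal (exp (e n) - exp (d n) / s) * V s \<le>
      (\<integral>\<^sup>+x. ennreal (min (exp (r * x)) ((real s)\<^sup>2)) \<partial>(A n \<star> B))" if s: "1 \<le> s" for n s
  proof -
    interpret An: real_distribution "A n" by (rule A)
    have [measurable_cong]: "sets (A n) = sets borel" "sets B = sets borel"
      by auto
    have pw: "exp (r * x) \<le> min (exp (r * x)) s + exp (2 * r * x) / s" for x
    proof (cases "exp (r * x) \<le> s")
      case False
      have "exp (r * x) * s \<le> exp (r * x) * exp (r * x)"
        using False by (intro mult_left_mono) auto
      also have "\<dots> = exp (2 * r * x)"
        by (simp add: exp_add[symmetric])
      finally have "exp (r * x) \<le> exp (2 * r * x) / s"
        using s by (simp add: field_simps)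
      then show ?thesis
        using s by (simp add: min_def)
    qed (use s in simp)
    have "ennreal (exp (e n)) = (\<integral>\<^sup>+x. ennreal (exp (r * x)) \<partial>A n)"
      by (simp add: first)
    also have "\<dots> \<le> (\<integral>\<^sup>+x. ennreal (min (exp (r * x)) s) + ennreal (1 / s) * ennreal (exp (2 * r * x)) \<partial>A n)"
      using pw s by (intro nn_integral_mono) (simp add: ennreal_plus[symmetric] ennreal_mult[symmetric] del: ennreal_plus)
    also have "\<dots> = (\<integral>\<^sup>+x. ennreal (min (exp (r * x)) s) \<partial>A n) + ennreal (exp (d n) / s)"
      using s by (subst nn_integral_add)
        (auto simp: nn_integral_cmult second, simp add: ennreal_mult[symmetric])
    finally have le: "ennreal (exp (e n) - exp (d n) / s) \<le> (\<integral>\<^sup>+x. ennreal (min (exp (r * x)) s) \<partial>A n)"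
      using s by (simp add: trunc_eq[OF A] ennreal_plus[symmetric] del: ennreal_plus)
    have "ennreal (exp (e n) - exp (d n) / s) * V s \<le>
        (\<integral>\<^sup>+x. ennreal (min (exp (r * x)) s) \<partial>A n) * V s"
      by (rule mult_right_mono[OF le]) simp
    also have "\<dots> = (\<integral>\<^sup>+x. \<integral>\<^sup>+y. ennreal (min (exp (r * x)) s) * ennreal (min (exp (r * y)) s) \<partial>B \<partial>A n)"
      unfolding V_def by (simp add: nn_integral_cmult nn_integral_multc)
    also have "\<dots> \<le> (\<integral>\<^sup>+x. \<integral>\<^sup>+y. ennreal (min (exp (r * (x + y))) ((real s)\<^sup>2)) \<partial>B \<partial>A n)"
    proof (intro nn_integral_mono)
      fix x y
      have "min (exp (r * x)) s * min (exp (r * y)) s \<le> exp (r * x) * exp (r * y)"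
        "min (exp (r * x)) s * min (exp (r * y)) s \<le> real s * real s"
        by (intro mult_mono; simp)+
      then show "ennreal (min (exp (r * x)) s) * ennreal (min (exp (r * y)) s) \<le>
          ennreal (min (exp (r * (x + y))) ((real s)\<^sup>2))"
        by (simp add: ennreal_mult[symmetric] exp_add distrib_left power2_eq_square ennreal_leI)
    qed
    also have "\<dots> = (\<integral>\<^sup>+x. ennreal (min (exp (r * x)) ((real s)\<^sup>2)) \<partial>(A n \<star> B))"
      by (subst nn_integral_convolution) (auto simp: An.finite_measure_axioms B.finite_measure_axioms)
    finally show ?thesis .
  qed
  have lower_s: "ennreal (exp e0 - exp d0 / s) * V s \<le> (\<integral>\<^sup>+x. ennreal (exp (r * x)) \<partial>L)" if s: "1 \<le> s" for s
  proof (rule order_trans[OF _ nn_integral_exp_truncated_le])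
    have "(\<lambda>n. ennreal (exp (e n) - exp (d n) / s) * V s) \<longlonglongrightarrow> ennreal (exp e0 - exp d0 / s) * V s"
      using V_fin[of s] s
      by (intro tendsto_mult_ennreal tendsto_const tendsto_ennrealI tendsto_diff tendsto_divide tendsto_exp first(2) second(2)) auto
    then show "ennreal (exp e0 - exp d0 / s) * V s \<le> (\<integral>\<^sup>+x. ennreal (min (exp (r * x)) ((real s)\<^sup>2)) \<partial>L)"
      by (rule LIMSEQ_le[OF _ trunc_lim]) (use lower_n[OF s] in auto)
  qed
  \<comment> \<open>As exp e0 is positive, the product of the limits is well behaved even if
    \<open>?LB\<close> is infinite.\<close>
  have "(\<lambda>s. ennreal (exp e0 - exp d0 / real s) * V s) \<longlonglongrightarrow> ennreal (exp e0 - 0) * ?LB"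
    by (intro tendsto_mult_ennreal tendsto_ennrealI tendsto_diff tendsto_const V_lim lim_const_over_n) auto
  then have "ennreal (exp e0) * ?LB \<le> (\<integral>\<^sup>+x. ennreal (exp (r * x)) \<partial>L)"
    using lower_s by (intro LIMSEQ_le_const2) auto
  with upper show ?thesis
    by (rule antisym)
qed

text \<open>Scaling the standard normal law includes the degenerate case s = 0, for which there is
  no density.\<close>

lemma normal_exists:
  obtains P where "real_distribution P"
    and "\<And>u. char P u = exp (- of_real (u\<^sup>2 * s\<^sup>2 / 2))"
    and "\<And>r. (\<integral>\<^sup>+x. ennreal (exp (r * x)) \<partial>P) = ennreal (exp (r\<^sup>2 * s\<^sup>2 / 2))"
proof -
  interpret std: prob_space std_normal_distribution
    by (rule prob_space_normal_density) simp
  have [measurable]: "(\<lambda>x. s * x) \<in> std_normal_distribution \<rightarrow>\<^sub>M borel"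
    by simp
  show ?thesis
  proof (rule that[of "distr std_normal_distribution borel (\<lambda>x. s * x)"])
    show "real_distribution (distr std_normal_distribution borel (\<lambda>x. s * x))"
      by (rule std.real_distribution_distr) simp
    show "char (distr std_normal_distribution borel (\<lambda>x. s * x)) u = exp (- of_real (u\<^sup>2 * s\<^sup>2 / 2))" for u
    proof -
      have "char (distr std_normal_distribution borel (\<lambda>x. s * x)) u = char std_normal_distribution (u * s)"
        unfolding char_def by (subst integral_distr) (auto simp: mult.assoc)
      then show ?thesis
        by (simp add: char_std_normal_distribution exp_of_real[symmetric] power_mult_distrib)
    qed
    show "(\<integral>\<^sup>+x. ennreal (exp (r * x)) \<partial>distr std_normal_distribution borel (\<lambda>x. s * x)) =
        ennreal (exp (r\<^sup>2 * s\<^sup>2 / 2))" for r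
    proof -
      have "(\<integral>\<^sup>+x. ennreal (exp (r * x)) \<partial>distr std_normal_distribution borel (\<lambda>x. s * x)) =
          (\<integral>\<^sup>+x. ennreal (std_normal_density x) * ennreal (exp (r * (s * x))) \<partial>lborel)"
        by (subst nn_integral_distr) (auto simp: nn_integral_density)
      \<comment> \<open>Completing the square turns the exponential weight into a shift of the mean
        to r s.\<close>
      also have "\<dots> = (\<integral>\<^sup>+x. ennreal (exp (r\<^sup>2 * s\<^sup>2 / 2)) * ennreal (normal_density (r * s) 1 x) \<partial>lborel)"
        by (intro nn_integral_cong)
           (simp add: normal_density_def ennreal_mult[symmetric] exp_add[symmetric] power2_eq_square field_simps)
      also have "\<dots> = ennreal (exp (r\<^sup>2 * s\<^sup>2 / 2))"
        by (subst nn_integral_cmult) (auto simp: nn_integral_eq_integral)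
      finally show ?thesis .
    qed
  qed
qed

text \<open>Second-order Taylor near 0 and the triangle inequality elsewhere; the constant is large
  enough for both. The hypothesis keeps the modulus of the exponential below exp (norm z) for large
  \<open>x\<close>. It holds for imaginary \<open>z\<close> and all \<open>x\<close>, as
  characteristic functions require, and for Re z \<le> 0 and x \<ge> - 1, as Laplace transforms
  require.\<close>

lemma norm_exp_minus_linear_le:
  fixes z :: complex and x :: real
  assumes "Re z * x \<le> \<bar>Re z\<bar>"
  shows "norm (exp (z * of_real x) - 1 - z * of_real x) \<le>
    (exp (norm z) * (1 + (norm z)\<^sup>2) + 1 + norm z) * min (x\<^sup>2) \<bar>x\<bar>"
proof (cases "\<bar>x\<bar> \<le> 1")
  case True
  have x2: "x\<^sup>2 \<le> \<bar>x\<bar>"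
    using mult_right_mono[OF True, of "\<bar>x\<bar>"] by (simp add: power2_eq_square abs_mult[symmetric])
  have "norm (exp (z * of_real x) - 1 - z * of_real x) \<le> exp \<bar>Re (z * of_real x)\<bar> * norm (z * of_real x) ^ 2"
    using Taylor_exp[of "z * of_real x" 1] by (simp add: diff_diff_eq power2_eq_square)
  also have "\<dots> \<le> exp (norm z) * ((norm z)\<^sup>2 * x\<^sup>2)"
  proof (intro mult_mono)
    have "\<bar>Re (z * of_real x)\<bar> \<le> \<bar>Re z\<bar>"
      using True by (simp add: abs_mult mult_left_le)
    then show "exp \<bar>Re (z * of_real x)\<bar> \<le> exp (norm z)"
      using abs_Re_le_cmod[of z] by simp
  qed (auto simp: norm_mult power_mult_distrib)
  also have "\<dots> \<le> (exp (norm z) * (1 + (norm z)\<^sup>2) + 1 + norm z) * x\<^sup>2"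
    unfolding mult.assoc[symmetric] by (intro mult_right_mono) (auto simp: distrib_left add_increasing)
  finally show ?thesis
    using x2 by (simp add: min_absorb1)
next
  case False
  then have x: "1 \<le> \<bar>x\<bar>" by simp
  have x2: "\<bar>x\<bar> \<le> x\<^sup>2"
    using mult_right_mono[OF x, of "\<bar>x\<bar>"] by (simp add: power2_eq_square abs_mult[symmetric])
  have "norm (exp (z * of_real x) - 1 - z * of_real x) \<le> norm (exp (z * of_real x)) + 1 + norm (z * of_real x)"
    using norm_triangle_ineq4[of "exp (z * of_real x) - 1" "z * of_real x"]
      norm_triangle_ineq4[of "exp (z * of_real x)" 1] by simp
  also have "\<dots> \<le> exp (norm z) * \<bar>x\<bar> + \<bar>x\<bar> + norm z * \<bar>x\<bar>"
  proof (intro add_mono)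
    have "norm (exp (z * of_real x)) \<le> exp (norm z)"
      using assms abs_Re_le_cmod[of z] by (simp add: norm_exp)
    then show "norm (exp (z * of_real x)) \<le> exp (norm z) * \<bar>x\<bar>"
      using x mult_mono[of "norm (exp (z * of_real x))" "exp (norm z)" 1 "\<bar>x\<bar>"] by simp
  qed (use x in \<open>auto simp: norm_mult\<close>)
  also have "\<dots> \<le> (exp (norm z) * (1 + (norm z)\<^sup>2) + 1 + norm z) * \<bar>x\<bar>"
    by (simp add: algebra_simps)
  finally show ?thesis
    using x2 by (simp add: min_absorb2)
qed

section \<open>From the Levy-Khintchine exponent to exponential moments\<close>

context
  fixes K :: "real measure"
  assumes sets_K [measurable_cong]: "sets K = sets borel"
    and finite_K: "(\<integral>\<^sup>+x\<in>- {0}. ennreal (min (x\<^sup>2) \<bar>x\<bar>) \<partial>K) < \<infinity>"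
begin

lemma integrable_min_square_abs: "integrable K (\<lambda>x. min (x\<^sup>2) \<bar>x\<bar>)"
proof (rule integrableI_nonneg)
  have "(\<integral>\<^sup>+x. ennreal (min (x\<^sup>2) \<bar>x\<bar>) \<partial>K) = (\<integral>\<^sup>+x\<in>- {0}. ennreal (min (x\<^sup>2) \<bar>x\<bar>) \<partial>K)"
    by (intro nn_integral_cong) (auto split: split_indicator)
  then show "(\<integral>\<^sup>+x. ennreal (min (x\<^sup>2) \<bar>x\<bar>) \<partial>K) < \<infinity>"
    using finite_K by simp
qed (auto simp: measurable_cong_sets[OF sets_K refl])

lemma integrable_dominated:
  fixes f :: "real \<Rightarrow> 'b::{banach, second_countable_topology}"
  assumes "f \<in> borel_measurable borel" "\<And>x. norm (f x) \<le> C * min (x\<^sup>2) \<bar>x\<bar>"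
  shows "integrable K f"
proof (rule Bochner_Integration.integrable_bound)
  show "integrable K (\<lambda>x. C * min (x\<^sup>2) \<bar>x\<bar>)"
    by (intro integrable_mult_right integrable_min_square_abs)
  show "AE x in K. norm (f x) \<le> norm (C * min (x\<^sup>2) \<bar>x\<bar>)"
    using assms(2) by (intro AE_I2) (simp add: order_trans[OF _ abs_ge_self])
qed (use assms(1) in \<open>simp add: measurable_cong_sets[OF sets_K refl]\<close>)

text \<open>At distance at least \<open>d\<close> from 0 the integrable function
  \<open>min (x\<^sup>2) \<bar>x\<bar>\<close> is bounded below by the positive number
  \<open>min (d\<^sup>2) d\<close>. The factor \<open>t\<close> is the time at which the process is
  observed.\<close>

lemma finite_measure_restricted:
  assumes [measurable]: "D \<in> sets borel" and "\<And>x. x \<in> D \<Longrightarrow> d \<le> \<bar>x\<bar>" "0 < d" "0 \<le> t"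
  shows "finite_measure (density K (\<lambda>x. ennreal (t * indicator D x)))"
proof
  have "integrable K (indicator D :: real \<Rightarrow> real)"
  proof (rule integrable_dominated)
    fix x :: real
    define m where "m = min (d\<^sup>2) d"
    have m: "0 < m" using assms by (simp add: m_def)
    show "norm (indicator D x :: real) \<le> 1 / m * min (x\<^sup>2) \<bar>x\<bar>"
    proof (cases "x \<in> D")
      case True
      have "d\<^sup>2 \<le> \<bar>x\<bar>\<^sup>2"
        using assms(2)[OF True] assms(3) by (intro power_mono) auto
      then have "m \<le> min (x\<^sup>2) \<bar>x\<bar>"
        using assms(2)[OF True] by (auto simp: m_def)
      then show ?thesis
        using True m by (simp add: field_simps)
    qed (use m in simp)
  qed simp
  then have "(\<integral>\<^sup>+x. ennreal t * ennreal (indicator D x) \<partial>K) < \<infinity>"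
    using assms(4) by (subst nn_integral_cmult)
      (auto simp: measurable_cong_sets[OF sets_K refl] nn_integral_eq_integral ennreal_mult_less_top)
  then show "emeasure (density K (\<lambda>x. ennreal (t * indicator D x))) (space (density K (\<lambda>x. ennreal (t * indicator D x)))) \<noteq> \<infinity>"
    using assms(4) sets_eq_imp_space_eq[OF sets_K]
    by (simp add: emeasure_density measurable_cong_sets[OF sets_K refl] ennreal_mult)
qed

text \<open>The law \<open>L\<close> is the weak limit of laws \<open>A n \<star> B\<close> whose
  exponential moments are explicit. The terms exp (z x) - 1 and z x of the exponent need not be
  integrable separately near 0; after the cut-off they are, and the linear one becomes part of the
  drift.\<close>

lemma nn_integral_exp_infinitely_divisible:
  fixes b c t a :: real and L :: "real measure"
  assumes L: "real_distribution L" and c: "0 \<le> c" and t: "0 < t" and a: "0 \<le> a"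
    and char_L: "\<And>u. char L u = exp (of_real t * levy_khintchine_exponent b c K u)"
  defines "J \<equiv> \<integral>\<^sup>+x\<in>- {0}. ennreal (exp (- a * x) - 1 + a * x) \<partial>K"
  shows "J < \<infinity> \<Longrightarrow> (\<integral>\<^sup>+x. ennreal (exp (- a * x)) \<partial>L) =
      ennreal (exp (- t * (a * b - a\<^sup>2 * c / 2 - enn2real J)))"
    and "J = \<infinity> \<Longrightarrow> (\<integral>\<^sup>+x. ennreal (exp (- a * x)) \<partial>L) = \<infinity>"
proof -
  \<comment> \<open>The lower bound on \<bar>x\<bar> makes the jump measure finite; the bound x
    \<ge> - 1 keeps its exponential moments of order - a finite.\<close>
  define D where "D n = {x::real. - 1 \<le> x \<and> 1 / real (Suc n) \<le> \<bar>x\<bar>}" for n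
  have D [measurable]: "D n \<in> sets borel" for n
    unfolding D_def by measurable
  define h :: "real \<Rightarrow> real" where "h x = min (x\<^sup>2) \<bar>x\<bar>" for x
  have h [measurable]: "h \<in> borel_measurable borel" "integrable K h" "0 \<le> h x" for x
    using integrable_min_square_abs by (auto simp: h_def[abs_def])
  have measurable_K: "f \<in> borel_measurable K" if "f \<in> borel_measurable borel" for f :: "real \<Rightarrow> 'z::topological_space"
    using that by (simp add: measurable_cong_sets[OF sets_K refl])
  \<comment> \<open>\<open>D n\<close> increases to {-1..} without the origin. At the origin the
    bound itself forces f 0 = 0.\<close>
  have D_lim: "(\<lambda>n. \<integral>x. indicator (D n) x *\<^sub>R f x \<partial>K) \<longlonglongrightarrow> (\<integral>x. indicator {-1..} x *\<^sub>R f x \<partial>K)"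
    if f [measurable]: "f \<in> borel_measurable borel" and le: "\<And>x. - 1 \<le> x \<Longrightarrow> norm (f x) \<le> C * h x"
    for f :: "real \<Rightarrow> 'z::{banach, second_countable_topology}" and C
  proof (rule integral_dominated_convergence)
    show "integrable K (\<lambda>x. \<bar>C\<bar> * h x)"
      using h by simp
    show "AE x in K. (\<lambda>n. indicator (D n) x *\<^sub>R f x) \<longlonglongrightarrow> indicator {-1..} x *\<^sub>R f x"
    proof (intro AE_I2)
      fix x :: real
      show "(\<lambda>n. indicator (D n) x *\<^sub>R f x) \<longlonglongrightarrow> indicator {-1..} x *\<^sub>R f x"
      proof (cases "x = 0")
        case True
        then have "f x = 0" using le[of x] by (simp add: h_def)
        then show ?thesis by simp
      next
        case False
        have "\<forall>\<^sub>F n in sequentially. inverse (real (Suc n)) < \<bar>x\<bar>"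
          using LIMSEQ_inverse_real_of_nat by (rule order_tendstoD) (use False in simp)
        then show ?thesis
          by (intro tendsto_eventually, elim eventually_mono)
             (auto simp: D_def indicator_def inverse_eq_divide)
      qed
    qed
    show "AE x in K. norm (indicator (D n) x *\<^sub>R f x) \<le> \<bar>C\<bar> * h x" for n
    proof (intro AE_I2)
      fix x
      have "C * h x \<le> \<bar>C\<bar> * h x"
        using h by (intro mult_right_mono) auto
      then show "norm (indicator (D n) x *\<^sub>R f x) \<le> \<bar>C\<bar> * h x"
        using le[of x] h(3)[of x] by (auto simp: D_def indicator_def)
    qed
  qed (auto intro!: measurable_K)
  \<comment> \<open>On \<open>D n\<close> one has \<bar>x\<bar> \<le> (n + 1) min (x^2)
    \<bar>x\<bar>, so linear growth suffices. The constant depends on \<open>n\<close>; uniformity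
    enters only through \<open>D_lim\<close>.\<close>
  have int_D: "integrable K (\<lambda>x. indicator (D n) x *\<^sub>R f x)"
    if f [measurable]: "f \<in> borel_measurable borel" and le: "\<And>x. - 1 \<le> x \<Longrightarrow> norm (f x) \<le> C * \<bar>x\<bar>" "0 \<le> C"
    for f :: "real \<Rightarrow> 'z::{banach, second_countable_topology}" and C n
  proof (rule integrable_dominated)
    show "norm (indicator (D n) x *\<^sub>R f x) \<le> (C * Suc n) * min (x\<^sup>2) \<bar>x\<bar>" for x
    proof (cases "x \<in> D n")
      case True
      have "\<bar>x\<bar> * 1 \<le> \<bar>x\<bar> * (Suc n * \<bar>x\<bar>)"
        using True by (intro mult_left_mono) (auto simp: D_def field_simps)
      moreover have "\<bar>x\<bar> * 1 \<le> \<bar>x\<bar> * real (Suc n)"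
        by (intro mult_left_mono) auto
      ultimately have "\<bar>x\<bar> \<le> Suc n * min (x\<^sup>2) \<bar>x\<bar>"
        by (auto simp: min_def power2_eq_square abs_mult_self_eq mult.commute mult.left_commute)
      then show ?thesis
        using True le(1)[of x] mult_left_mono[OF _ le(2), of "\<bar>x\<bar>" "Suc n * min (x\<^sup>2) \<bar>x\<bar>"]
        by (auto simp: D_def mult.assoc)
    qed (use le in simp)
  qed auto
  have int_B: "integrable K (\<lambda>x. indicator {..<-1} x *\<^sub>R f x)"
    if f [measurable]: "f \<in> borel_measurable borel" and le: "\<And>x. x < - 1 \<Longrightarrow> norm (f x) \<le> C * \<bar>x\<bar>" "0 \<le> C"
    for f :: "real \<Rightarrow> 'z::{banach, second_countable_topology}" and C
  proof (rule integrable_dominated)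
    show "norm (indicator {..<-1} x *\<^sub>R f x) \<le> C * min (x\<^sup>2) \<bar>x\<bar>" for x
    proof (cases "x < - 1")
      case True
      then have "\<bar>x\<bar> * 1 \<le> \<bar>x\<bar> * \<bar>x\<bar>"
        by (intro mult_left_mono) auto
      then show ?thesis
        using True le(1)[of x] by (simp add: min_absorb2 power2_eq_square)
    qed (use le in simp)
  qed auto

  define N where "N n = density K (\<lambda>x. ennreal (t * indicator (D n) x))" for n
  define NB where "NB = density K (\<lambda>x. ennreal (t * indicator {..<-1} x))"
  have fin: "finite_measure (N n)" "finite_measure NB" for n
    unfolding N_def NB_def using t
    by (intro finite_measure_restricted[where d="1 / real (Suc n)"] finite_measure_restricted[where d=1];
        auto simp: D_def)+
  have sets_N: "sets (N n) = sets borel" "sets NB = sets borel" for n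
    by (auto simp: N_def NB_def sets_K)
  have integral_N: "integral\<^sup>L (N n) f = t *\<^sub>R (\<integral>x. indicator (D n) x *\<^sub>R f x \<partial>K)"
    if "f \<in> borel_measurable borel" for f :: "real \<Rightarrow> 'z::{banach, second_countable_topology}" and n
    unfolding N_def using t measurable_K[OF that]
    by (subst integral_density)
      (auto intro!: measurable_K simp del: scaleR_scaleR simp: scaleR_scaleR[symmetric])
  have integral_NB: "integral\<^sup>L NB f = t *\<^sub>R (\<integral>x. indicator {..<-1} x *\<^sub>R f x \<partial>K)"
    if "f \<in> borel_measurable borel" for f :: "real \<Rightarrow> 'z::{banach, second_countable_topology}"
    unfolding NB_def using t measurable_K[OF that]
    by (subst integral_density)
      (auto intro!: measurable_K simp del: scaleR_scaleR simp: scaleR_scaleR[symmetric])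

  have "\<exists>P. real_distribution P \<and> (\<forall>u. char P u = exp (CLINT x|N n. iexp (u * x) - 1)) \<and>
    (\<forall>r. (\<integral>\<^sup>+x. ennreal (exp (r * x)) \<partial>N n) < \<infinity> \<longrightarrow>
      (\<integral>\<^sup>+x. ennreal (exp (r * x)) \<partial>P) = ennreal (exp (LINT x|N n. exp (r * x) - 1)))" for n
    by (rule compound_poisson_exists[OF sets_N(1) fin(1), of n]) blast
  then obtain P where P: "\<And>n. real_distribution (P n)"
    "\<And>n u. char (P n) u = exp (CLINT x|N n. iexp (u * x) - 1)"
    "\<And>n r. (\<integral>\<^sup>+x. ennreal (exp (r * x)) \<partial>N n) < \<infinity> \<Longrightarrow>
      (\<integral>\<^sup>+x. ennreal (exp (r * x)) \<partial>P n) = ennreal (exp (LINT x|N n. exp (r * x) - 1))"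
    by metis
  obtain B where B: "real_distribution B"
    "\<And>u. char B u = exp (CLINT x|NB. iexp (u * x) - 1)"
    "\<And>r. (\<integral>\<^sup>+x. ennreal (exp (r * x)) \<partial>NB) < \<infinity> \<Longrightarrow>
      (\<integral>\<^sup>+x. ennreal (exp (r * x)) \<partial>B) = ennreal (exp (LINT x|NB. exp (r * x) - 1))"
    "\<And>r. (\<integral>\<^sup>+x. ennreal (exp (r * x)) \<partial>NB) = \<infinity> \<Longrightarrow> (\<integral>\<^sup>+x. ennreal (exp (r * x)) \<partial>B) = \<infinity>"
    by (rule compound_poisson_exists[OF sets_N(2) fin(2)]) blast
  obtain G where G: "real_distribution G"
    "\<And>u. char G u = exp (- of_real (u\<^sup>2 * (sqrt (t * c))\<^sup>2 / 2))"
    "\<And>r. (\<integral>\<^sup>+x. ennreal (exp (r * x)) \<partial>G) = ennreal (exp (r\<^sup>2 * (sqrt (t * c))\<^sup>2 / 2))"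
    using normal_exists[of "sqrt (t * c)"] by blast
  have tc: "(sqrt (t * c))\<^sup>2 = t * c"
    using t c by simp
  \<comment> \<open>\<open>A n\<close> carries the drift, the Gaussian part and the jumps in \<open>D n\<close>; \<open>B\<close> carries the jumps
    below \<open>- 1\<close>, the only ones for which the exponential moments may be infinite.\<close>
  define mB where "mB = (\<integral>x. indicator {..<-1} x *\<^sub>R x \<partial>K)"
  define m where "m n = (\<integral>x. indicator (D n) x *\<^sub>R x \<partial>K)" for n
  \<comment> \<open>The exponents of \<open>P n\<close> and \<open>B\<close> lack the compensating
    term - z x. The shift \<open>s n\<close> supplies it by subtracting the means \<open>m n\<close>
    and \<open>mB\<close> from the drift.\<close>
  define s where "s n = t * (b - m n - mB)" for n
  define A where "A n = ((G \<star> P n) \<star> return borel (s n))" for n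
  have GP: "real_distribution (G \<star> P n)" for n
    by (intro real_distribution_convolution G P)
  have A: "real_distribution (A n)" for n
    unfolding A_def by (intro real_distribution_convolution GP real_distribution_return)

  \<comment> \<open>A complex \<open>z\<close> serves both purposes: z = \<i> u for characteristic
    functions and real z \<le> 0 for exponential moments.\<close>
  define F where "F z x = exp (z * of_real x) - 1 - z * of_real x" for z :: complex and x :: real
  have F [measurable]: "F z \<in> borel_measurable borel" for z
    unfolding F_def by measurable
  define C where "C z = exp (norm z) * (1 + (norm z)\<^sup>2) + 1 + norm z" for z :: complex
  have C: "0 \<le> C z" for z
    by (simp add: C_def add_nonneg_nonneg)
  have F_le: "norm (F z x) \<le> C z * h x" if "Re z * x \<le> \<bar>Re z\<bar>" for z x
    unfolding F_def C_def h_def using norm_exp_minus_linear_le[OF that] .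
  have F_le1: "norm (F z x) \<le> C z * h x" if "Re z \<le> 0" "- 1 \<le> x" for z x
    using mult_left_mono_neg[OF that(2,1)] that(1) by (intro F_le) simp
  have h_le: "h x \<le> \<bar>x\<bar>" for x
    by (simp add: h_def)
  have F_le2: "norm (F z x) \<le> C z * \<bar>x\<bar>" if "Re z * x \<le> \<bar>Re z\<bar>" for z x
    using F_le[OF that] mult_left_mono[OF h_le[of x] C[of z]] by (rule order_trans)

  have split_D: "(\<integral>x. indicator (D n) x *\<^sub>R (exp (z * of_real x) - 1) \<partial>K) =
      (\<integral>x. indicator (D n) x *\<^sub>R F z x \<partial>K) + z * of_real (m n)" if z: "Re z \<le> 0" for z :: complex and n
  proof -
    have int_F: "integrable K (\<lambda>x. indicator (D n) x *\<^sub>R F z x)"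
      by (rule int_D[of "F z" "C z", OF F _ C]) (rule order_trans[OF F_le1[OF z] mult_left_mono[OF h_le C]])
    have "integrable K (\<lambda>x. indicator (D n) x *\<^sub>R x)"
      by (rule int_D[of "\<lambda>x. x" 1]) auto
    then have int_x: "integrable K (\<lambda>x. z * of_real (indicator (D n) x *\<^sub>R x))"
      by (intro integrable_mult_right integrable_of_real)
    have "z * of_real (m n) = (\<integral>x. z * of_real (indicator (D n) x *\<^sub>R x) \<partial>K)"
      unfolding m_def by (simp only: integral_mult_right_zero integral_complex_of_real)
    then show ?thesis
      by (simp only: Bochner_Integration.integral_add[OF int_F int_x, symmetric])
         (auto intro!: Bochner_Integration.integral_cong simp: F_def indicator_def)
  qed
  have split_B: "(\<integral>x. indicator {..<-1} x *\<^sub>R (exp (z * of_real x) - 1) \<partial>K) =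
      (\<integral>x. indicator {..<-1} x *\<^sub>R F z x \<partial>K) + z * of_real mB"
    if int_F: "integrable K (\<lambda>x. indicator {..<-1} x *\<^sub>R F z x)" for z :: complex
  proof -
    have "integrable K (\<lambda>x. indicator {..<-1} x *\<^sub>R x)"
      by (rule int_B[of "\<lambda>x. x" 1]) auto
    then have int_x: "integrable K (\<lambda>x. z * of_real (indicator {..<-1} x *\<^sub>R x))"
      by (intro integrable_mult_right integrable_of_real)
    have "z * of_real mB = (\<integral>x. z * of_real (indicator {..<-1} x *\<^sub>R x) \<partial>K)"
      unfolding mB_def by (simp only: integral_mult_right_zero integral_complex_of_real)
    then show ?thesis
      by (simp only: Bochner_Integration.integral_add[OF int_F int_x, symmetric])
         (auto intro!: Bochner_Integration.integral_cong simp: F_def indicator_def)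
  qed

  have char_lim: "(\<lambda>n. char (A n) u * char B u) \<longlonglongrightarrow> char L u" for u
  proof -
    let ?z = "\<i> * of_real u :: complex"
    have intB: "integrable K (\<lambda>x. indicator {..<-1} x *\<^sub>R F ?z x)"
      by (rule int_B[of "F ?z" "C ?z", OF F _ C]) (rule F_le2, simp)
    have iexp: "iexp (u * x) = exp (?z * of_real x)" for x
      by (simp add: mult.assoc)
    let ?E = "\<lambda>I. of_real t * (?z * of_real b - of_real (u\<^sup>2 * c / 2) + I + (\<integral>x. indicator {..<-1} x *\<^sub>R F ?z x \<partial>K))"
    have int_N: "(CLINT x|N n. exp (?z * of_real x) - 1) =
        of_real t * ((\<integral>x. indicator (D n) x *\<^sub>R F ?z x \<partial>K) + ?z * of_real (m n))" for n
      by (subst integral_N, simp) (subst split_D, simp_all add: scaleR_conv_of_real)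
    have int_NB: "(CLINT x|NB. exp (?z * of_real x) - 1) =
        of_real t * ((\<integral>x. indicator {..<-1} x *\<^sub>R F ?z x \<partial>K) + ?z * of_real mB)"
      by (subst integral_NB, simp) (subst split_B[OF intB], simp add: scaleR_conv_of_real)
    have "char (A n) u * char B u = exp (?E (\<integral>x. indicator (D n) x *\<^sub>R F ?z x \<partial>K))" for n
      unfolding A_def char_convolution[OF GP real_distribution_return] char_convolution[OF G(1) P(1)]
        G(2) P(2) B(2) char_return iexp int_N int_NB tc exp_add[symmetric]
      by (rule arg_cong[where f=exp]) (simp add: s_def algebra_simps)
    moreover have "(\<lambda>n. exp (?E (\<integral>x. indicator (D n) x *\<^sub>R F ?z x \<partial>K))) \<longlonglongrightarrow>
        exp (?E (\<integral>x. indicator {-1..} x *\<^sub>R F ?z x \<partial>K))"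
      by (intro tendsto_intros D_lim[of "F ?z" "C ?z"] F F_le1) auto
    moreover have "exp (?E (\<integral>x. indicator {-1..} x *\<^sub>R F ?z x \<partial>K)) = char L u"
    proof -
      \<comment> \<open>For imaginary \<open>?z\<close> the bound \<open>F_le\<close> holds on the
        whole line, so the two half-line integrals add up. The excluded origin does not matter since
        \<open>F ?z 0 = 0\<close>.\<close>
      have "integrable K (F ?z)"
        by (rule integrable_dominated[where C="C ?z"]) (use F_le[of ?z] in \<open>auto simp: h_def\<close>)
      then have "integrable K (\<lambda>x. indicator {-1..} x *\<^sub>R F ?z x)"
        by (intro integrable_mult_indicator) (auto simp: sets_K)
      then have "(\<integral>x. indicator {-1..} x *\<^sub>R F ?z x \<partial>K) + (\<integral>x. indicator {..<-1} x *\<^sub>R F ?z x \<partial>K) =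
          (\<integral>x. indicator (- {0}) x *\<^sub>R F ?z x \<partial>K)"
        by (subst Bochner_Integration.integral_add[symmetric, OF _ intB])
           (auto intro!: Bochner_Integration.integral_cong simp: indicator_def F_def)
      then show ?thesis
        unfolding char_L levy_khintchine_exponent_def set_lebesgue_integral_def
        by (simp add: add.assoc F_def mult.assoc)
    qed
    ultimately show ?thesis by simp
  qed

  define f where "f r x = exp (r * x) - 1 - r * x" for r x :: real
  have f [measurable]: "f r \<in> borel_measurable borel" for r
    unfolding f_def by measurable
  have F_of_real: "F (of_real r) x = of_real (f r x)" for r x
    by (simp add: F_def f_def exp_of_real[symmetric])
  have f_nonneg: "0 \<le> f r x" for r x
    using exp_ge_add_one_self[of "r * x"] unfolding f_def by linarith
  have f_le: "norm (f r x) \<le> C (of_real r) * h x" if "r \<le> 0" "- 1 \<le> x" for r x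
    using F_le1[of "of_real r" x] that by (simp add: F_of_real)
  define e where "e r I = t * (r * b - r * mB + r\<^sup>2 * c / 2 + I)" for r I
  have laplace_A: "(\<integral>\<^sup>+x. ennreal (exp (r * x)) \<partial>A n) =
      ennreal (exp (e r (\<integral>x. indicator (D n) x *\<^sub>R f r x \<partial>K)))" if r: "r \<le> 0" for n r
  proof -
    interpret N: finite_measure "N n" by (rule fin)
    have exp_D: "exp (r * x) \<le> exp (- r)" if "- 1 \<le> x" for x
      using mult_left_mono_neg[OF that r] by simp
    have "(\<integral>\<^sup>+x. ennreal (exp (r * x)) \<partial>N n) =
        (\<integral>\<^sup>+x. ennreal (t * indicator (D n) x) * ennreal (exp (r * x)) \<partial>K)"
      unfolding N_def by (subst nn_integral_density) (auto intro!: measurable_K)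
    also have "\<dots> \<le> (\<integral>\<^sup>+x. ennreal (t * indicator (D n) x) * ennreal (exp (- r)) \<partial>K)"
      using exp_D by (intro nn_integral_mono) (auto simp: indicator_def D_def ennreal_leI intro!: mult_left_mono)
    also have "\<dots> = (\<integral>\<^sup>+x. ennreal (exp (- r)) \<partial>N n)"
      unfolding N_def by (subst nn_integral_density) (auto intro!: measurable_K)
    also have "\<dots> < \<infinity>"
      by (simp add: ennreal_mult_less_top N.emeasure_eq_measure)
    finally have fin_exp: "(\<integral>\<^sup>+x. ennreal (exp (r * x)) \<partial>N n) < \<infinity>" .
    \<comment> \<open>The real decomposition is read off from \<open>split_D\<close> at a real
      argument, by injectivity of \<open>of_real\<close>.\<close>
    have "indicator (D n) x *\<^sub>R (exp (of_real r * of_real x) - 1) =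
        (of_real (indicator (D n) x *\<^sub>R (exp (r * x) - 1)) :: complex)" for x
      by (simp add: exp_of_real[symmetric] scaleR_conv_of_real)
    moreover have "indicator (D n) x *\<^sub>R F (of_real r) x = of_real (indicator (D n) x *\<^sub>R f r x)" for x
      by (simp add: F_of_real scaleR_conv_of_real)
    moreover have "Re (of_real r) \<le> 0"
      using r by simp
    ultimately have real_split: "(\<integral>x. indicator (D n) x *\<^sub>R (exp (r * x) - 1) \<partial>K) =
        (\<integral>x. indicator (D n) x *\<^sub>R f r x \<partial>K) + r * m n"
      using split_D[of "of_real r" n]
      by (simp only: integral_complex_of_real of_real_mult[symmetric] of_real_add[symmetric] of_real_eq_iff)
    show ?thesis
      unfolding A_def nn_integral_exp_convolution[OF GP real_distribution_return]
        nn_integral_exp_convolution[OF G(1) P(1)] G(3) P(3)[OF fin_exp] nn_integral_exp_return tc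
      by (subst integral_N, simp, unfold real_split)
         (simp add: ennreal_mult[symmetric] exp_add[symmetric] e_def s_def algebra_simps)
  qed
  have e_lim: "(\<lambda>n. e r (\<integral>x. indicator (D n) x *\<^sub>R f r x \<partial>K)) \<longlonglongrightarrow> e r (\<integral>x. indicator {-1..} x *\<^sub>R f r x \<partial>K)"
    if "r \<le> 0" for r
    unfolding e_def by (intro tendsto_intros D_lim[of "f r" "C (of_real r)"] f f_le that)
  \<comment> \<open>The second moments needed for the weak limit are exponential moments of order -
    2 a, again nonpositive, so \<open>laplace_A\<close> and \<open>e_lim\<close> cover both
    orders.\<close>
  have laplace_L: "(\<integral>\<^sup>+x. ennreal (exp (- a * x)) \<partial>L) =
      ennreal (exp (e (- a) (\<integral>x. indicator {-1..} x *\<^sub>R f (- a) x \<partial>K))) * (\<integral>\<^sup>+x. ennreal (exp (- a * x)) \<partial>B)"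
  proof -
    have a1: "- a \<le> 0" and a2: "2 * - a \<le> 0"
      using a by auto
    show ?thesis
      by (rule nn_integral_exp_weak_limit[OF A B(1) L char_lim laplace_A[OF a1] e_lim[OF a1] laplace_A[OF a2] e_lim[OF a2]])
  qed

  have int_f1: "integrable K (\<lambda>x. indicator {-1..} x *\<^sub>R f (- a) x)"
  proof (rule integrable_dominated[where C="C (of_real (- a))"])
    show "norm (indicator {-1..} x *\<^sub>R f (- a) x) \<le> C (of_real (- a)) * min (x\<^sup>2) \<bar>x\<bar>" for x
      using f_le[of "- a" x] a C by (auto simp: indicator_def h_def)
  qed auto
  define JB where "JB = (\<integral>\<^sup>+x. ennreal (indicator {..<-1} x *\<^sub>R f (- a) x) \<partial>K)"
  \<comment> \<open>The part over x \<ge> - 1 is always finite, so \<open>J\<close> and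
    \<open>JB\<close> are infinite together.\<close>
  have J: "J = ennreal (\<integral>x. indicator {-1..} x *\<^sub>R f (- a) x \<partial>K) + JB"
  proof -
    have "J = (\<integral>\<^sup>+x. ennreal (indicator {-1..} x *\<^sub>R f (- a) x) + ennreal (indicator {..<-1} x *\<^sub>R f (- a) x) \<partial>K)"
      unfolding J_def by (intro nn_integral_cong) (auto simp: indicator_def f_def)
    also have "\<dots> = (\<integral>\<^sup>+x. ennreal (indicator {-1..} x *\<^sub>R f (- a) x) \<partial>K) + JB"
      unfolding JB_def by (intro nn_integral_add) (auto intro!: measurable_K)
    also have "(\<integral>\<^sup>+x. ennreal (indicator {-1..} x *\<^sub>R f (- a) x) \<partial>K) = ennreal (\<integral>x. indicator {-1..} x *\<^sub>R f (- a) x \<partial>K)"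
      using int_f1 f_nonneg by (intro nn_integral_eq_integral) auto
    finally show ?thesis .
  qed
  have NB_eq: "(\<integral>\<^sup>+x. ennreal (exp (- a * x)) \<partial>NB) =
      ennreal t * (\<integral>\<^sup>+x. ennreal (indicator {..<-1} x * exp (- a * x)) \<partial>K)"
    unfolding NB_def using t
    by (subst nn_integral_density)
       (auto intro!: measurable_K nn_integral_cong simp: nn_integral_cmult[symmetric] ennreal_mult[symmetric] mult.assoc)
  have int_lin: "integrable K (\<lambda>x. indicator {..<-1} x *\<^sub>R (1 - a * x))"
  proof (rule int_B)
    show "norm (1 - a * x) \<le> (1 + a) * \<bar>x\<bar>" if "x < - 1" for x
      using a mult_nonneg_nonpos[of a x] that by (simp add: distrib_right)
  qed (use a in auto)
  \<comment> \<open>Below - 1 the functions exp (- a x) and f (- a) x differ by 1 - a x, which is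
    nonnegative and integrable there. Thus the exponential moment of \<open>B\<close> is finite
    exactly if \<open>J\<close> is.\<close>
  have fin_iff: "(\<integral>\<^sup>+x. ennreal (exp (- a * x)) \<partial>NB) < \<infinity> \<longleftrightarrow> JB < \<infinity>"
  proof -
    have "(\<integral>\<^sup>+x. ennreal (indicator {..<-1} x * exp (- a * x)) \<partial>K) =
        (\<integral>\<^sup>+x. ennreal (indicator {..<-1} x *\<^sub>R f (- a) x) + ennreal (indicator {..<-1} x *\<^sub>R (1 - a * x)) \<partial>K)"
    proof (intro nn_integral_cong)
      fix x :: real
      have "0 \<le> 1 - a * x" if "x < - 1"
        using a mult_left_mono[of x 0 a] that by simp
      then show "ennreal (indicator {..<-1} x * exp (- a * x)) =
          ennreal (indicator {..<-1} x *\<^sub>R f (- a) x) + ennreal (indicator {..<-1} x *\<^sub>R (1 - a * x))"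
        using f_nonneg[of "- a" x]
        by (auto simp: indicator_def f_def ennreal_plus[symmetric] simp del: ennreal_plus)
    qed
    also have "\<dots> = JB + (\<integral>\<^sup>+x. ennreal (indicator {..<-1} x *\<^sub>R (1 - a * x)) \<partial>K)"
      unfolding JB_def by (intro nn_integral_add) (auto intro!: measurable_K)
    finally show ?thesis
      unfolding NB_eq using t integrableD(2)[OF int_lin]
      by (auto simp: ennreal_mult_less_top less_top[symmetric] ennreal_mult_eq_top_iff)
  qed

  {
    assume "J < \<infinity>"
    then have JB: "JB < \<infinity>"
      by (simp add: J)
    have int_fB: "integrable K (\<lambda>x. indicator {..<-1} x *\<^sub>R f (- a) x)"
      using JB f_nonneg unfolding JB_def by (intro integrableI_nonneg) (auto intro!: measurable_K)
    have JB_eq: "JB = ennreal (\<integral>x. indicator {..<-1} x *\<^sub>R f (- a) x \<partial>K)"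
      unfolding JB_def using int_fB f_nonneg by (intro nn_integral_eq_integral) auto
    have J_eq: "enn2real J = (\<integral>x. indicator {-1..} x *\<^sub>R f (- a) x \<partial>K) + (\<integral>x. indicator {..<-1} x *\<^sub>R f (- a) x \<partial>K)"
    proof -
      have "0 \<le> (\<integral>x. indicator D x *\<^sub>R f (- a) x \<partial>K)" for D
        using f_nonneg by (intro integral_nonneg_AE) auto
      then show ?thesis
        unfolding J JB_eq by (subst ennreal_plus[symmetric]) (auto simp del: ennreal_plus)
    qed
    have "(\<integral>x. indicator {..<-1} x *\<^sub>R (exp (- a * x) - 1) \<partial>K) =
        (\<integral>x. indicator {..<-1} x *\<^sub>R f (- a) x \<partial>K) + (- a) * mB"
    proof -
      have *: "integrable K (\<lambda>x. indicator {..<-1} x *\<^sub>R x)"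
        by (rule int_B[of "\<lambda>x. x" 1]) auto
      then have int_x: "integrable K (\<lambda>x. (- a) * (indicator {..<-1} x *\<^sub>R x))"
        by simp
      have "(- a) * mB = (\<integral>x. (- a) * (indicator {..<-1} x *\<^sub>R x) \<partial>K)"
        unfolding mB_def by simp
      then show ?thesis
        by (simp only: Bochner_Integration.integral_add[OF int_fB int_x, symmetric])
           (auto intro!: Bochner_Integration.integral_cong simp: f_def indicator_def)
    qed
    then have "(\<integral>\<^sup>+x. ennreal (exp (- a * x)) \<partial>B) =
        ennreal (exp (t * ((\<integral>x. indicator {..<-1} x *\<^sub>R f (- a) x \<partial>K) - a * mB)))"
      using JB by (subst B(3)[OF fin_iff[THEN iffD2]]) (auto simp: integral_NB)
    then show "(\<integral>\<^sup>+x. ennreal (exp (- a * x)) \<partial>L) = ennreal (exp (- t * (a * b - a\<^sup>2 * c / 2 - enn2real J)))"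
      unfolding laplace_L J_eq
      by (simp add: ennreal_mult[symmetric] exp_add[symmetric] e_def algebra_simps)
  next
    assume "J = \<infinity>"
    then have "JB = \<infinity>"
      by (simp add: J)
    then have "(\<integral>\<^sup>+x. ennreal (exp (- a * x)) \<partial>NB) = \<infinity>"
      using fin_iff by (simp add: less_top[symmetric])
    then show "(\<integral>\<^sup>+x. ennreal (exp (- a * x)) \<partial>L) = \<infinity>"
      unfolding laplace_L by (subst B(4)) (auto simp: ennreal_mult_top)
  }
qed

end

subsection \<open>Moments of the exponential functional\<close>

text \<open>The integral of f s1 * ... * f sn over t \<le> s1 \<le> ... \<le> sn, with the smallest
  time outermost. In this order each new time only adds one increment after the earlier
  ones.\<close>

fun ordered_integral :: "(real \<Rightarrow> ennreal) \<Rightarrow> nat \<Rightarrow> real \<Rightarrow> ennreal" where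
  "ordered_integral f 0 t = 1"
| "ordered_integral f (Suc n) t = (\<integral>\<^sup>+s\<in>{t..}. f s * ordered_integral f n s \<partial>lborel)"

lemma borel_measurable_ordered_integral_param:
  assumes [measurable]: "(\<lambda>(s, \<omega>). f s \<omega>) \<in> borel_measurable (borel \<Otimes>\<^sub>M M)"
  shows "(\<lambda>(t, \<omega>). ordered_integral (\<lambda>s. f s \<omega>) n t) \<in> borel_measurable (borel \<Otimes>\<^sub>M M)"
proof (induction n)
  case (Suc n)
  note Suc [measurable]
  have "(\<lambda>(s, \<omega>). f s \<omega> * ordered_integral (\<lambda>s. f s \<omega>) n s) \<in> borel_measurable (borel \<Otimes>\<^sub>M M)"
    by measurable
  note this [measurable]
  \<comment> \<open>The set {t..} moves with the parameter; written as a condition on (t, s), its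
    indicator is visibly jointly measurable.\<close>
  have "(\<lambda>(t, \<omega>). \<integral>\<^sup>+s. (f s \<omega> * ordered_integral (\<lambda>s. f s \<omega>) n s) * (if t \<le> s then 1 else 0) \<partial>lborel)
      \<in> borel_measurable (borel \<Otimes>\<^sub>M M)"
    by measurable
  also have "(\<lambda>(t, \<omega>). \<integral>\<^sup>+s. (f s \<omega> * ordered_integral (\<lambda>s. f s \<omega>) n s) * (if t \<le> s then 1 else 0) \<partial>lborel) =
      (\<lambda>(t, \<omega>). ordered_integral (\<lambda>s. f s \<omega>) (Suc n) t)"
    by (auto simp: fun_eq_iff indicator_def intro!: nn_integral_cong)
  finally show ?case .
qed simp

lemma borel_measurable_ordered_integral:
  assumes [measurable]: "f \<in> borel_measurable borel"
  shows "ordered_integral f n \<in> borel_measurable borel"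
proof -
  have "(\<lambda>(t, \<omega>::unit). ordered_integral (\<lambda>s. f s) n t) \<in> borel_measurable (borel \<Otimes>\<^sub>M count_space UNIV)"
    by (rule borel_measurable_ordered_integral_param) measurable
  from measurable_compose[OF measurable_Pair2'[of "()"] this]
  show ?thesis by simp
qed

text \<open>The domain \<open>{t..} \<times> {t..}\<close> of the double integral is split along its diagonal.\<close>

lemma integral_times_ordered_integral:
  assumes [measurable]: "f \<in> borel_measurable borel"
  shows "(\<integral>\<^sup>+s\<in>{t..}. f s \<partial>lborel) * ordered_integral f n t = of_nat (Suc n) * ordered_integral f (Suc n) t"
proof (induction n arbitrary: t)
  case (Suc n)
  note borel_measurable_ordered_integral[OF assms, measurable]
  let ?S = "ordered_integral f"
  let ?F = "\<lambda>t. \<integral>\<^sup>+s\<in>{t..}. f s \<partial>lborel"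
  let ?i = "\<lambda>P::bool. if P then 1 else 0 :: ennreal"
  have "?F t * ?S (Suc n) t = (\<integral>\<^sup>+s. (\<integral>\<^sup>+u. (f u * ?i (t \<le> u)) * (f s * ?S n s * ?i (t \<le> s)) \<partial>lborel) \<partial>lborel)"
    by (simp add: nn_integral_cmult nn_integral_multc indicator_def of_bool_def)
  \<comment> \<open>\<open>u\<close> is the extra variable and \<open>s\<close> the smallest of the
    ordered ones. The first summand has s \<le> u; in the second t \<le> u < s, so the condition t
    \<le> s is implied.\<close>
  also have "\<dots> = (\<integral>\<^sup>+s. (\<integral>\<^sup>+u. (f s * ?S n s * ?i (t \<le> s)) * (f u * ?i (s \<le> u)) +
      f u * ?i (t \<le> u) * (f s * ?S n s * ?i (u < s)) \<partial>lborel) \<partial>lborel)"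
    by (intro nn_integral_cong) (auto simp: ac_simps)
  also have "\<dots> = (\<integral>\<^sup>+s. (\<integral>\<^sup>+u. (f s * ?S n s * ?i (t \<le> s)) * (f u * ?i (s \<le> u)) \<partial>lborel) +
      (\<integral>\<^sup>+u. f u * ?i (t \<le> u) * (f s * ?S n s * ?i (u < s)) \<partial>lborel) \<partial>lborel)"
    by (intro nn_integral_cong nn_integral_add) measurable
  also have "\<dots> = (\<integral>\<^sup>+s. (\<integral>\<^sup>+u. (f s * ?S n s * ?i (t \<le> s)) * (f u * ?i (s \<le> u)) \<partial>lborel) \<partial>lborel) +
      (\<integral>\<^sup>+s. (\<integral>\<^sup>+u. f u * ?i (t \<le> u) * (f s * ?S n s * ?i (u < s)) \<partial>lborel) \<partial>lborel)"
    by (intro nn_integral_add) measurable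
  also have "(\<integral>\<^sup>+s. (\<integral>\<^sup>+u. (f s * ?S n s * ?i (t \<le> s)) * (f u * ?i (s \<le> u)) \<partial>lborel) \<partial>lborel) =
      (\<integral>\<^sup>+s. f s * ?i (t \<le> s) * (?F s * ?S n s) \<partial>lborel)"
    by (intro nn_integral_cong, subst nn_integral_cmult)
       (auto simp: indicator_def of_bool_def ac_simps)
  \<comment> \<open>The induction hypothesis at \<open>s\<close> inserts \<open>u\<close> among the
    later times, giving Suc n copies; the other half of the domain, where \<open>u\<close> is the
    new smallest time, gives one more.\<close>
  also have "\<dots> = (\<integral>\<^sup>+s. of_nat (Suc n) * (f s * ?S (Suc n) s * ?i (t \<le> s)) \<partial>lborel)"
    unfolding Suc.IH by (intro nn_integral_cong) (simp add: ac_simps)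
  also have "\<dots> = of_nat (Suc n) * ?S (Suc (Suc n)) t"
    by (subst nn_integral_cmult) (auto simp: indicator_def of_bool_def simp del: ordered_integral.simps of_nat_Suc simp: ordered_integral.simps(2)[of f "Suc n"])
  also have "(\<integral>\<^sup>+s. (\<integral>\<^sup>+u. f u * ?i (t \<le> u) * (f s * ?S n s * ?i (u < s)) \<partial>lborel) \<partial>lborel) =
      (\<integral>\<^sup>+u. (\<integral>\<^sup>+s. f u * ?i (t \<le> u) * (f s * ?S n s * ?i (u < s)) \<partial>lborel) \<partial>lborel)"
    by (rule lborel_pair.Fubini') measurable
  also have "\<dots> = (\<integral>\<^sup>+u. f u * ?i (t \<le> u) * (\<integral>\<^sup>+s. f s * ?S n s * ?i (u < s) \<partial>lborel) \<partial>lborel)"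
    by (intro nn_integral_cong nn_integral_cmult) measurable
  also have "\<dots> = (\<integral>\<^sup>+u. f u * ?i (t \<le> u) * ?S (Suc n) u \<partial>lborel)"
  proof (intro nn_integral_cong arg_cong2[where f="(*)"] refl)
    fix u :: real
    have "(\<integral>\<^sup>+s. f s * ?S n s * ?i (u < s) \<partial>lborel) = (\<integral>\<^sup>+s. f s * ?S n s * ?i (u \<le> s) \<partial>lborel)"
      using AE_lborel_singleton[of u] by (intro nn_integral_cong_AE) (auto elim!: eventually_mono)
    then show "(\<integral>\<^sup>+s. f s * ?S n s * ?i (u < s) \<partial>lborel) = ?S (Suc n) u"
      by (simp add: indicator_def of_bool_def)
  qed
  also have "\<dots> = ?S (Suc (Suc n)) t"
    by (auto simp: indicator_def of_bool_def ac_simps simp del: ordered_integral.simps simp: ordered_integral.simps(2)[of f "Suc n"] intro!: nn_integral_cong)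
  finally show ?case
    by (simp add: distrib_right ac_simps del: ordered_integral.simps)
qed simp

lemma nn_integral_power_eq_ordered_integral:
  assumes [measurable]: "f \<in> borel_measurable borel"
  shows "(\<integral>\<^sup>+s\<in>{t..}. f s \<partial>lborel) ^ n = fact n * ordered_integral f n t"
proof (induction n)
  case (Suc n)
  have "(\<integral>\<^sup>+s\<in>{t..}. f s \<partial>lborel) ^ Suc n = fact n * ((\<integral>\<^sup>+s\<in>{t..}. f s \<partial>lborel) * ordered_integral f n t)"
    using Suc by (simp add: ac_simps)
  also have "\<dots> = fact (Suc n) * ordered_integral f (Suc n) t"
    unfolding integral_times_ordered_integral[OF assms] by (simp add: ac_simps del: ordered_integral.simps)
  finally show ?case .
qed simp

text \<open>The path is sampled at the grid point (floor (t (n + 1)) + 1) / (n + 1), which lies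
  strictly to the right of \<open>t\<close> and tends to it. Each approximation uses countably many
  random variables. The inner \<open>max\<close> keeps the sampling time nonnegative for every
  integer index, as required by \<open>measurable_compose_countable\<close>.\<close>

lemma borel_measurable_right_continuous_process:
  fixes Y :: "real \<Rightarrow> 'a \<Rightarrow> real"
  assumes Y [measurable]: "\<And>t. 0 \<le> t \<Longrightarrow> Y t \<in> borel_measurable M"
    and right_cont: "\<And>\<omega> t. \<omega> \<in> space M \<Longrightarrow> 0 \<le> t \<Longrightarrow> continuous (at_right t) (\<lambda>t. Y t \<omega>)"
  shows "(\<lambda>(t, \<omega>). Y (max t 0) \<omega>) \<in> borel_measurable (borel \<Otimes>\<^sub>M M)"
proof (rule borel_measurable_LIMSEQ_real)
  let ?U = "\<lambda>n i (p :: real \<times> 'a). Y ((max (real_of_int i) 0 + 1) / real (Suc n)) (snd p)"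
  let ?g = "\<lambda>n (p :: real \<times> 'a). \<lfloor>max (fst p) 0 * real (Suc n)\<rfloor>"
  show "(\<lambda>p. ?U n (?g n p) p) \<in> borel_measurable (borel \<Otimes>\<^sub>M M)" for n
  proof (rule measurable_compose_countable[where f="?U n" and g="?g n"])
    show "?U n i \<in> borel_measurable (borel \<Otimes>\<^sub>M M)" for i
      by (rule measurable_compose[OF measurable_snd Y]) simp
    show "?g n \<in> borel \<Otimes>\<^sub>M M \<rightarrow>\<^sub>M count_space UNIV"
      by measurable
  qed
  fix p :: "real \<times> 'a" assume "p \<in> space (borel \<Otimes>\<^sub>M M)"
  then obtain t \<omega> where p: "p = (t, \<omega>)" "\<omega> \<in> space M"
    by (auto simp: space_pair_measure)
  define r where "r = max t 0"
  define s where "s n = (max (real_of_int \<lfloor>r * real (Suc n)\<rfloor>) 0 + 1) / real (Suc n)" for n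
  have r: "0 \<le> r" by (simp add: r_def)
  have fl: "max (real_of_int \<lfloor>r * real (Suc n)\<rfloor>) 0 = real_of_int \<lfloor>r * real (Suc n)\<rfloor>" for n
    using r by (intro max_absorb1) simp
  have s_gt: "r < s n" for n
    unfolding s_def fl by (simp add: pos_less_divide_eq del: of_nat_Suc)
  have s_le: "s n \<le> r + inverse (real (Suc n))" for n
    unfolding s_def fl
    using of_int_floor_le[of "r * real (Suc n)"] by (simp add: field_simps del: of_nat_Suc)
  have "s \<longlonglongrightarrow> r"
  proof (rule tendsto_sandwich[of "\<lambda>_. r" s _ "\<lambda>n. r + inverse (real (Suc n))"])
    show "(\<lambda>n. r + inverse (real (Suc n))) \<longlonglongrightarrow> r"
      using LIMSEQ_inverse_real_of_nat_add[of r] by simp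
  qed (use s_gt s_le in \<open>auto intro!: always_eventually less_imp_le\<close>)
  then have "filterlim s (at_right r) sequentially"
    by (rule tendsto_imp_filterlim_at_right) (use s_gt in auto)
  then have "(\<lambda>n. Y (s n) \<omega>) \<longlonglongrightarrow> Y r \<omega>"
    using right_cont[OF p(2) r] unfolding continuous_within by (rule filterlim_compose[rotated])
  then show "(\<lambda>n. ?U n (?g n p) p) \<longlonglongrightarrow> (case p of (t, \<omega>) \<Rightarrow> Y (max t 0) \<omega>)"
    by (simp add: p s_def r_def)
qed

text \<open>Tonelli for paths and expectation requires joint measurability. The paths are set to 0
  on a null set containing the bad ones, and negative times, about which nothing is assumed, are
  sent to 0.\<close>

lemma (in levy_process) jointly_measurable_modification:
  obtains Y where "(\<lambda>(t, \<omega>). Y t \<omega>) \<in> borel_measurable (borel \<Otimes>\<^sub>M M)"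
    and "AE \<omega> in M. X 0 \<omega> = 0 \<and> (\<forall>t\<ge>0. Y t \<omega> = X t \<omega>)"
proof -
  obtain N where N: "{\<omega> \<in> space M. \<not> cadlag (\<lambda>t. X t \<omega>)} \<subseteq> N" "N \<in> null_sets M"
    using cadlag_paths by (elim AE_E) (auto simp: null_sets_def)
  have [measurable]: "N \<in> sets M"
    using N(2) by auto
  define Y where "Y t \<omega> = (if \<omega> \<in> N then 0 else X t \<omega>)" for t \<omega>
  show ?thesis
  proof (rule that[of "\<lambda>t. Y (max t 0)"])
    show "(\<lambda>(t, \<omega>). Y (max t 0) \<omega>) \<in> borel_measurable (borel \<Otimes>\<^sub>M M)"
    proof (rule borel_measurable_right_continuous_process)
      show "Y t \<in> borel_measurable M" if "0 \<le> t" for t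
        using random_variable_X[OF that] unfolding Y_def by measurable
      show "continuous (at_right t) (\<lambda>t. Y t \<omega>)" if "\<omega> \<in> space M" "0 \<le> t" for \<omega> t
        using N(1) that by (cases "\<omega> \<in> N") (auto simp: Y_def cadlag_def)
    qed
    show "AE \<omega> in M. X 0 \<omega> = 0 \<and> (\<forall>t\<ge>0. Y (max t 0) \<omega> = X t \<omega>)"
      using starts_at_0 AE_not_in[OF N(2)] by eventually_elim (auto simp: Y_def)
  qed
qed

text \<open>Summation by parts: the increment from \<open>i\<close> to \<open>Suc i\<close> enters
  the values at Suc i, ..., m, hence m - i times.\<close>

lemma sum_eq_weighted_increments:
  fixes y :: "nat \<Rightarrow> real"
  assumes "y 0 = 0"
  shows "(\<Sum>i<m. y (Suc i)) = (\<Sum>i<m. real (m - i) * (y (Suc i) - y i))"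
proof (induction m)
  case (Suc m)
  have tele: "(\<Sum>i<Suc m. y (Suc i) - y i) = y (Suc m)"
    using assms by (simp only: sum_lessThan_telescope)
  have "(\<Sum>i<Suc m. real (Suc m - i) * (y (Suc i) - y i)) =
      (\<Sum>i<Suc m. real (m - i) * (y (Suc i) - y i) + (y (Suc i) - y i))"
    by (intro sum.cong) (auto simp: Suc_diff_le algebra_simps)
  also have "\<dots> = (\<Sum>i<m. real (m - i) * (y (Suc i) - y i)) + y (Suc m)"
    unfolding sum.distrib tele by simp
  finally show ?case
    using Suc by simp
qed simp

text \<open>The integral over the ordered simplex factors over the increments of \<open>X\<close>: in the product of
  the \<open>exp (- X (s i))\<close> the \<open>i\<close>-th increment occurs once for every later time.\<close>

lemma (in levy_process) exp_functional_moment_eq_prod: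
  "exp_functional_moment M X n = fact n *
    (\<Prod>k=1..n. \<integral>\<^sup>+h\<in>{0..}. (\<integral>\<^sup>+\<omega>. ennreal (exp (- real k * X h \<omega>)) \<partial>M) \<partial>lborel)"
proof -
  obtain Y where Y [measurable]: "(\<lambda>(t, \<omega>). Y t \<omega>) \<in> borel_measurable (borel \<Otimes>\<^sub>M M)"
    and Y_eq: "AE \<omega> in M. X 0 \<omega> = 0 \<and> (\<forall>t\<ge>0. Y t \<omega> = X t \<omega>)"
    by (rule jointly_measurable_modification)
  define f where "f t \<omega> = ennreal (exp (- Y t \<omega>))" for t \<omega>
  have f [measurable]: "(\<lambda>(t, \<omega>). f t \<omega>) \<in> borel_measurable (borel \<Otimes>\<^sub>M M)"
    unfolding f_def by measurable
  have [measurable]: "f t \<in> borel_measurable M" for t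
    by measurable
  note S = borel_measurable_ordered_integral_param[OF f, measurable]
  define \<Lambda> where "\<Lambda> k h = (\<integral>\<^sup>+\<omega>. f h \<omega> ^ k \<partial>M)" for k :: nat and h
  have \<Lambda> [measurable]: "\<Lambda> k \<in> borel_measurable borel" for k
    unfolding \<Lambda>_def by measurable
  have \<Lambda>_eq: "\<Lambda> k h = (\<integral>\<^sup>+\<omega>. ennreal (exp (- real k * X h \<omega>)) \<partial>M)" if "0 \<le> h" for k h
    unfolding \<Lambda>_def using Y_eq
    by (intro nn_integral_cong_AE, eventually_elim)
       (use that in \<open>simp add: f_def ennreal_power exp_of_nat_mult[symmetric]\<close>)
  define R where "R n = (\<Prod>k=1..n. \<integral>\<^sup>+h\<in>{0..}. \<Lambda> k h \<partial>lborel)" for n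
  interpret P: pair_sigma_finite lborel M ..
  \<comment> \<open>Generalized for the induction: the times \<tau> 1, ..., \<tau> m are frozen and
    \<open>n\<close> later ones are still integrated. Increment \<open>i\<close> occurs at m - i
    frozen times and at all \<open>n\<close> later ones, which explains the index m + n - i.\<close>
  have main: "(\<integral>\<^sup>+\<omega>. (\<Prod>i<m. f (\<tau> (Suc i)) \<omega>) * ordered_integral (\<lambda>s. f s \<omega>) n (\<tau> m) \<partial>M) =
      (\<Prod>i<m. \<Lambda> (m + n - i) (\<tau> (Suc i) - \<tau> i)) * R n"
    if "\<tau> 0 = 0" "\<And>i. i < m \<Longrightarrow> \<tau> i \<le> \<tau> (Suc i)" for m n \<tau>
    using that
  proof (induction n arbitrary: m \<tau>)
    case 0
    have \<tau>_nonneg: "0 \<le> \<tau> i" if "i \<le> m" for i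
      using that by (induction i) (use 0 in \<open>auto intro: order_trans\<close>)
    let ?D = "\<lambda>i \<omega>. X (\<tau> (Suc i)) \<omega> - X (\<tau> i) \<omega>"
    have "indep_vars (\<lambda>_. borel) ?D {..<m}"
      using 0 by (intro indep_increments) auto
    then have indep: "indep_vars (\<lambda>_. borel) (\<lambda>i \<omega>. ennreal (exp (- real (m - i) * ?D i \<omega>))) {..<m}"
      by (rule indep_vars_compose2) measurable
    have "(\<integral>\<^sup>+\<omega>. (\<Prod>i<m. f (\<tau> (Suc i)) \<omega>) * ordered_integral (\<lambda>s. f s \<omega>) 0 (\<tau> m) \<partial>M) =
        (\<integral>\<^sup>+\<omega>. (\<Prod>i<m. ennreal (exp (- real (m - i) * ?D i \<omega>))) \<partial>M)"
      using Y_eq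
    proof (intro nn_integral_cong_AE, eventually_elim)
      fix \<omega> assume \<omega>: "X 0 \<omega> = 0 \<and> (\<forall>t\<ge>0. Y t \<omega> = X t \<omega>)"
      have "(\<Prod>i<m. f (\<tau> (Suc i)) \<omega>) = (\<Prod>i<m. ennreal (exp (- X (\<tau> (Suc i)) \<omega>)))"
        using \<omega> \<tau>_nonneg by (intro prod.cong) (auto simp: f_def)
      also have "\<dots> = ennreal (exp (- (\<Sum>i<m. X (\<tau> (Suc i)) \<omega>)))"
        by (simp add: prod_ennreal exp_sum sum_negf[symmetric])
      also have "- (\<Sum>i<m. X (\<tau> (Suc i)) \<omega>) = (\<Sum>i<m. - real (m - i) * ?D i \<omega>)"
        using sum_eq_weighted_increments[of "\<lambda>i. X (\<tau> i) \<omega>" m] \<omega> 0(1)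
        by (simp only: mult_minus_left sum_negf)
      also have "ennreal (exp (\<Sum>i<m. - real (m - i) * ?D i \<omega>)) = (\<Prod>i<m. ennreal (exp (- real (m - i) * ?D i \<omega>)))"
        by (simp add: prod_ennreal exp_sum)
      finally show "(\<Prod>i<m. f (\<tau> (Suc i)) \<omega>) * ordered_integral (\<lambda>s. f s \<omega>) 0 (\<tau> m) =
          (\<Prod>i<m. ennreal (exp (- real (m - i) * ?D i \<omega>)))"
        by simp
    qed
    also have "\<dots> = (\<Prod>i<m. \<integral>\<^sup>+\<omega>. ennreal (exp (- real (m - i) * ?D i \<omega>)) \<partial>M)"
      by (rule indep_vars_nn_integral[OF _ indep]) auto
    also have "\<dots> = (\<Prod>i<m. \<Lambda> (m - i) (\<tau> (Suc i) - \<tau> i))"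
    proof (intro prod.cong refl)
      fix i assume "i \<in> {..<m}"
      then have i: "0 \<le> \<tau> i" "0 \<le> \<tau> (Suc i)" "0 \<le> \<tau> (Suc i) - \<tau> i"
        using \<tau>_nonneg 0(2) by auto
      note [measurable] = random_variable_X[OF i(1)] random_variable_X[OF i(2)] random_variable_X[OF i(3)]
      have "(\<integral>\<^sup>+\<omega>. ennreal (exp (- real (m - i) * ?D i \<omega>)) \<partial>M) =
          (\<integral>\<^sup>+x. ennreal (exp (- real (m - i) * x)) \<partial>distr M borel (?D i))"
        by (subst nn_integral_distr) auto
      also have "distr M borel (?D i) = distr M borel (X (\<tau> (Suc i) - \<tau> i))"
        using stationary_increments[OF i(1,3)] by simp
      also have "(\<integral>\<^sup>+x. ennreal (exp (- real (m - i) * x)) \<partial>distr M borel (X (\<tau> (Suc i) - \<tau> i))) =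
          \<Lambda> (m - i) (\<tau> (Suc i) - \<tau> i)"
        unfolding \<Lambda>_eq[OF i(3)] by (subst nn_integral_distr) auto
      finally show "(\<integral>\<^sup>+\<omega>. ennreal (exp (- real (m - i) * ?D i \<omega>)) \<partial>M) = \<Lambda> (m - i) (\<tau> (Suc i) - \<tau> i)" .
    qed
    finally show ?case
      by (simp add: R_def)
  next
    case (Suc n)
    let ?W = "\<lambda>\<omega>. \<Prod>i<m. f (\<tau> (Suc i)) \<omega>"
    let ?S = "\<lambda>n \<omega>. ordered_integral (\<lambda>s. f s \<omega>) n"
    let ?V = "\<Prod>i<m. \<Lambda> (m + Suc n - i) (\<tau> (Suc i) - \<tau> i)"
    have "(\<integral>\<^sup>+\<omega>. ?W \<omega> * ?S (Suc n) \<omega> (\<tau> m) \<partial>M) =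
        (\<integral>\<^sup>+\<omega>. (\<integral>\<^sup>+s. ?W \<omega> * f s \<omega> * ?S n \<omega> s * indicator {\<tau> m..} s \<partial>lborel) \<partial>M)"
    proof (intro nn_integral_cong)
      fix \<omega> assume [measurable]: "\<omega> \<in> space M"
      have [measurable]: "(\<lambda>s. f s \<omega>) \<in> borel_measurable borel"
        by measurable
      note borel_measurable_ordered_integral[OF this, measurable]
      show "?W \<omega> * ?S (Suc n) \<omega> (\<tau> m) = (\<integral>\<^sup>+s. ?W \<omega> * f s \<omega> * ?S n \<omega> s * indicator {\<tau> m..} s \<partial>lborel)"
        by (simp add: nn_integral_cmult[symmetric] mult.assoc)
    qed
    also have "\<dots> = (\<integral>\<^sup>+s. (\<integral>\<^sup>+\<omega>. ?W \<omega> * f s \<omega> * ?S n \<omega> s * indicator {\<tau> m..} s \<partial>M) \<partial>lborel)"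
      by (rule P.Fubini') measurable
    also have "\<dots> = (\<integral>\<^sup>+s. ?V * R n * (\<Lambda> (Suc n) (s - \<tau> m) * indicator {\<tau> m..} s) \<partial>lborel)"
    proof (intro nn_integral_cong)
      fix s :: real
      show "(\<integral>\<^sup>+\<omega>. ?W \<omega> * f s \<omega> * ?S n \<omega> s * indicator {\<tau> m..} s \<partial>M) =
          ?V * R n * (\<Lambda> (Suc n) (s - \<tau> m) * indicator {\<tau> m..} s)"
      proof (cases "\<tau> m \<le> s")
        case True
        \<comment> \<open>The outermost integration variable becomes frozen time number Suc m. The
          old indices agree since Suc m + n - i = m + Suc n - i, and the new increment has index Suc
          n.\<close>
        let ?\<tau> = "\<tau>(Suc m := s)"
        have "(\<integral>\<^sup>+\<omega>. (\<Prod>i<Suc m. f (?\<tau> (Suc i)) \<omega>) * ?S n \<omega> (?\<tau> (Suc m)) \<partial>M) =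
            (\<Prod>i<Suc m. \<Lambda> (Suc m + n - i) (?\<tau> (Suc i) - ?\<tau> i)) * R n"
          using Suc.prems True by (intro Suc.IH) (auto simp: less_Suc_eq)
        moreover have "(\<Prod>i<m. f (?\<tau> (Suc i)) \<omega>) = ?W \<omega>" for \<omega>
          by (intro prod.cong) auto
        moreover have "(\<Prod>i<m. \<Lambda> (Suc m + n - i) (?\<tau> (Suc i) - ?\<tau> i)) = ?V"
          by (intro prod.cong) auto
        ultimately show ?thesis
          using True by (simp add: ac_simps)
      qed simp
    qed
    also have "\<dots> = ?V * R n * (\<integral>\<^sup>+s. \<Lambda> (Suc n) (s - \<tau> m) * indicator {\<tau> m..} s \<partial>lborel)"
      by (rule nn_integral_cmult) measurable
    also have "(\<integral>\<^sup>+s. \<Lambda> (Suc n) (s - \<tau> m) * indicator {\<tau> m..} s \<partial>lborel) = (\<integral>\<^sup>+h\<in>{0..}. \<Lambda> (Suc n) h \<partial>lborel)"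
      by (subst nn_integral_real_affine[where c=1 and t="\<tau> m"])
         (auto intro!: nn_integral_cong simp: indicator_def)
    finally show ?case
      by (simp add: R_def ac_simps)
  qed

  have "exp_functional_moment M X n = (\<integral>\<^sup>+\<omega>. (\<integral>\<^sup>+s\<in>{0..}. f s \<omega> \<partial>lborel) ^ n \<partial>M)"
    unfolding exp_functional_moment_def exp_functional_def using Y_eq
    by (intro nn_integral_cong_AE, eventually_elim)
       (auto intro!: arg_cong[where f="\<lambda>x. x ^ n"] nn_integral_cong simp: f_def indicator_def)
  also have "\<dots> = (\<integral>\<^sup>+\<omega>. fact n * ordered_integral (\<lambda>s. f s \<omega>) n 0 \<partial>M)"
    by (intro nn_integral_cong nn_integral_power_eq_ordered_integral) measurable
  also have "\<dots> = fact n * (\<integral>\<^sup>+\<omega>. ordered_integral (\<lambda>s. f s \<omega>) n 0 \<partial>M)"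
    by (intro nn_integral_cmult) measurable
  also have "(\<integral>\<^sup>+\<omega>. ordered_integral (\<lambda>s. f s \<omega>) n 0 \<partial>M) = R n"
    using main[of "\<lambda>_. 0" 0 n] by simp
  also have "R n = (\<Prod>k=1..n. \<integral>\<^sup>+h\<in>{0..}. (\<integral>\<^sup>+\<omega>. ennreal (exp (- real k * X h \<omega>)) \<partial>M) \<partial>lborel)"
    unfolding R_def by (intro prod.cong nn_integral_cong) (auto simp: \<Lambda>_eq indicator_def)
  finally show ?thesis .
qed

subsection \<open>The Laplace exponent\<close>

lemma exp_minus_linear_nonneg: "0 \<le> exp (- a * x) - 1 + a * x" for a x :: real
  using exp_ge_add_one_self[of "- a * x"] unfolding mult_minus_left by linarith

text \<open>Convexity of \<open>exp\<close> on the segment from 0 to - r x, with weight a / r at the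
  far end.\<close>

lemma exp_minus_linear_scale_le:
  fixes a r x :: real
  assumes "0 < a" "a \<le> r"
  shows "exp (- a * x) - 1 + a * x \<le> a / r * (exp (- r * x) - 1 + r * x)"
proof -
  have "exp ((1 - a / r) *\<^sub>R 0 + (a / r) *\<^sub>R (- r * x)) \<le> (1 - a / r) * exp 0 + (a / r) * exp (- r * x)"
    using assms by (intro convex_onD[OF exp_convex]) auto
  then show ?thesis
    using assms by (simp add: algebra_simps)
qed

lemma nn_integral_exp_decay:
  assumes "0 < p"
  shows "(\<integral>\<^sup>+h\<in>{0..}. ennreal (exp (- h * p)) \<partial>lborel) = ennreal (1 / p)"
proof -
  have "(\<integral>\<^sup>+h. ennreal (exp (- h * p)) * indicator {0..} h \<partial>lborel) = ennreal (0 - (- exp (- 0 * p) / p))"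
  proof (rule nn_integral_FTC_atLeast)
    show "((\<lambda>h. - exp (- h * p) / p) has_real_derivative exp (- h * p)) (at h)" for h
      using assms by (auto intro!: derivative_eq_intros)
    show "((\<lambda>h. - exp (- h * p) / p) \<longlongrightarrow> 0) at_top"
      using assms by real_asymp
  qed auto
  then show ?thesis by simp
qed

section \<open>Finiteness of the moments in terms of the sign of the exponent\<close>

context levy_process_with_parameters
begin

context
  assumes finite_K0: "(\<integral>\<^sup>+x\<in>- {0}. ennreal (min (x\<^sup>2) \<bar>x\<bar>) \<partial>K0) < \<infinity>"
begin

abbreviation "\<Phi> \<equiv> laplace_exponent b0 c0 K0"

lemma sets_K0: "sets K0 = sets borel" and emeasure_K0_zero: "emeasure K0 {0} = 0"
  using levy_measure_K0 by (auto simp: levy_measure_def)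

lemma borel_measurable_K0: "f \<in> borel_measurable borel \<Longrightarrow> f \<in> borel_measurable K0"
  for f :: "real \<Rightarrow> 'b::topological_space"
  by (simp add: measurable_cong_sets[OF sets_K0 refl])

lemma nn_integral_exp_eq:
  assumes t: "0 < t" and a: "0 \<le> a"
  shows "\<Phi> a = ereal p \<Longrightarrow> (\<integral>\<^sup>+\<omega>. ennreal (exp (- a * X t \<omega>)) \<partial>M) = ennreal (exp (- t * p))"
    and "\<Phi> a = - \<infinity> \<Longrightarrow> (\<integral>\<^sup>+\<omega>. ennreal (exp (- a * X t \<omega>)) \<partial>M) = \<infinity>"
    and "\<Phi> a \<noteq> \<infinity>"
proof -
  note [measurable] = random_variable_X[OF less_imp_le[OF t]]
  have L: "real_distribution (distr M borel (X t))"
    by (rule real_distribution_distr) measurable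
  have distr: "(\<integral>\<^sup>+\<omega>. ennreal (exp (- a * X t \<omega>)) \<partial>M) = (\<integral>\<^sup>+x. ennreal (exp (- a * x)) \<partial>distr M borel (X t))"
    by (subst nn_integral_distr) auto
  let ?J = "\<integral>\<^sup>+x\<in>- {0}. ennreal (exp (- a * x) - 1 + a * x) \<partial>K0"
  note eq = nn_integral_exp_infinitely_divisible[OF sets_K0 finite_K0 L c0_nonneg t a levy_khintchine[OF less_imp_le[OF t]]]
  have fin: "\<Phi> a = ereal (a * b0 - a\<^sup>2 * c0 / 2 - enn2real ?J)" if "?J < \<infinity>"
    using that unfolding laplace_exponent_def
    by (cases ?J) (auto simp: enn2ereal_ennreal)
  have inf: "\<Phi> a = - \<infinity>" if "?J = \<infinity>"
    using that unfolding laplace_exponent_def by simp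
  show "(\<integral>\<^sup>+\<omega>. ennreal (exp (- a * X t \<omega>)) \<partial>M) = ennreal (exp (- t * p))" if "\<Phi> a = ereal p"
    using that eq(1) fin inf unfolding distr by (cases "?J = \<infinity>") (auto simp: less_top)
  show "(\<integral>\<^sup>+\<omega>. ennreal (exp (- a * X t \<omega>)) \<partial>M) = \<infinity>" if "\<Phi> a = - \<infinity>"
    using that eq(2) fin inf unfolding distr by (cases "?J = \<infinity>") (auto simp: less_top)
  show "\<Phi> a \<noteq> \<infinity>"
    using fin inf by (cases "?J = \<infinity>") (auto simp: less_top)
qed

text \<open>For positive \<Phi> a the inner expectation decays exponentially in \<open>h\<close>;
  otherwise it is at least 1 on a half-line of infinite length. That \<open>I\<close> is nonzero is
  recorded because 0 times infinity is 0 in \<open>ennreal\<close>, so a vanishing factor could hide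
  an infinite one in the product.\<close>

lemma nn_integral_laplace_transform:
  assumes a: "0 \<le> a"
  defines "I \<equiv> \<integral>\<^sup>+h\<in>{0..}. (\<integral>\<^sup>+\<omega>. ennreal (exp (- a * X h \<omega>)) \<partial>M) \<partial>lborel"
  shows "0 < \<Phi> a \<Longrightarrow> I \<noteq> 0 \<and> I \<noteq> \<infinity>" and "\<not> 0 < \<Phi> a \<Longrightarrow> I = \<infinity>"
proof -
  assume pos: "0 < \<Phi> a"
  then obtain p where p: "\<Phi> a = ereal p" "0 < p"
    using nn_integral_exp_eq(3)[OF zero_less_one a] by (cases "\<Phi> a") auto
  have "I = (\<integral>\<^sup>+h\<in>{0..}. ennreal (exp (- h * p)) \<partial>lborel)"
    unfolding I_def using AE_lborel_singleton[of 0]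
  proof (intro nn_integral_cong_AE, eventually_elim)
    fix h :: real
    assume "h \<noteq> 0"
    then show "(\<integral>\<^sup>+\<omega>. ennreal (exp (- a * X h \<omega>)) \<partial>M) * indicator {0..} h = ennreal (exp (- h * p)) * indicator {0..} h"
      using nn_integral_exp_eq(1)[OF _ a p(1), of h] by (cases "0 \<le> h") auto
  qed
  then show "I \<noteq> 0 \<and> I \<noteq> \<infinity>"
    using p(2) unfolding nn_integral_exp_decay[OF p(2)] by simp
next
  assume "\<not> 0 < \<Phi> a"
  then have ge: "1 \<le> (\<integral>\<^sup>+\<omega>. ennreal (exp (- a * X h \<omega>)) \<partial>M)" if "0 < h" for h
    using nn_integral_exp_eq[OF that a] that
    by (cases "\<Phi> a") (auto simp: zero_ereal_def mult_nonneg_nonpos)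
  have "(\<top> :: ennreal) \<le> emeasure lborel {0::real<..}"
  proof (rule LIMSEQ_le_const2[OF of_nat_tendsto_top_ennreal], intro exI allI impI)
    fix n :: nat
    have "of_nat n = emeasure lborel {0<..real n}"
      by (simp add: ennreal_of_nat_eq_real_of_nat)
    also have "\<dots> \<le> emeasure lborel {0::real<..}"
      by (intro emeasure_mono) auto
    finally show "of_nat n \<le> emeasure lborel {0::real<..}" .
  qed
  also have "emeasure lborel {0::real<..} = (\<integral>\<^sup>+h. indicator {0::real<..} h \<partial>lborel)"
    by simp
  also have "\<dots> \<le> I"
    unfolding I_def using ge by (intro nn_integral_mono) (auto simp: indicator_def)
  finally show "I = \<infinity>"
    by (simp add: top_unique)
qed

lemma exp_functional_moment_finite_iff:
  "exp_functional_moment M X n < \<infinity> \<longleftrightarrow> (\<forall>k\<in>{1..n}. 0 < \<Phi> (real k))"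
proof -
  let ?I = "\<lambda>k. \<integral>\<^sup>+h\<in>{0..}. (\<integral>\<^sup>+\<omega>. ennreal (exp (- real k * X h \<omega>)) \<partial>M) \<partial>lborel"
  have I: "?I k \<noteq> 0 \<and> (?I k = \<top> \<longleftrightarrow> \<not> 0 < \<Phi> (real k))" for k
    using nn_integral_laplace_transform[of "real k"] by (cases "0 < \<Phi> (real k)") auto
  have "(\<Prod>k=1..n. ?I k) = \<top> \<longleftrightarrow> (\<exists>k\<in>{1..n}. \<not> 0 < \<Phi> (real k))"
    using I by (subst ennreal_prod_eq_top) auto
  moreover have "exp_functional_moment M X n = \<top> \<longleftrightarrow> (\<Prod>k=1..n. ?I k) = \<top>"
    unfolding exp_functional_moment_eq_prod by (auto simp: ennreal_mult_eq_top_iff)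
  ultimately show ?thesis
    by (auto simp: less_top)
qed

text \<open>Concavity together with \<Phi> 0 = 0 gives \<Phi> a \<ge> (a / r) \<Phi> r. The integral
  is compared in \<open>ennreal\<close> first, so that its finiteness at \<open>r\<close> carries
  over to \<open>a\<close>.\<close>

lemma laplace_exponent_pos_mono:
  assumes "0 < \<Phi> r" "0 < a" "a \<le> r"
  shows "0 < \<Phi> a"
proof -
  let ?J = "\<lambda>a. \<integral>\<^sup>+x\<in>- {0}. ennreal (exp (- a * x) - 1 + a * x) \<partial>K0"
  have "?J r \<noteq> \<infinity>"
    using assms(1) by (auto simp: laplace_exponent_def)
  then obtain j where j: "?J r = ennreal j" "0 \<le> j"
    by (cases "?J r") auto
  have "?J a \<le> (\<integral>\<^sup>+x. ennreal (a / r) * (ennreal (exp (- r * x) - 1 + r * x) * indicator (- {0}) x) \<partial>K0)"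
    using assms exp_minus_linear_scale_le[OF assms(2,3)]
    by (intro nn_integral_mono) (auto simp: indicator_def ennreal_mult[symmetric] exp_minus_linear_nonneg[unfolded mult_minus_left] intro!: ennreal_leI)
  also have "\<dots> = ennreal (a / r) * ?J r"
    by (intro nn_integral_cmult borel_measurable_K0) measurable
  also have "\<dots> = ennreal (a / r * j)"
    using assms unfolding j(1) by (intro ennreal_mult'[symmetric]) simp
  finally have le: "?J a \<le> ennreal (a / r * j)" .
  then obtain i where i: "?J a = ennreal i" "0 \<le> i"
    by (cases "?J a") (auto simp: top_unique)
  have i_le: "i \<le> a / r * j"
    using le i j assms by (simp add: ennreal_le_iff)
  have "0 < r * b0 - r\<^sup>2 * c0 / 2 - j"
    using assms(1) j unfolding laplace_exponent_def by (simp add: enn2ereal_ennreal)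
  then have "0 < a / r * (r * b0 - r\<^sup>2 * c0 / 2 - j)"
    using assms by (intro mult_pos_pos) auto
  also have "\<dots> = a * b0 - a * r * c0 / 2 - a / r * j"
    using assms by (simp add: field_simps power2_eq_square)
  also have "\<dots> \<le> a * b0 - a\<^sup>2 * c0 / 2 - i"
    using i_le assms c0_nonneg
    by (intro diff_mono) (auto simp: power2_eq_square mult_right_mono mult_left_mono)
  finally show ?thesis
    unfolding laplace_exponent_def i using i(2) by (simp add: enn2ereal_ennreal)
qed

text \<open>A failure at some k \<le> n bounds the infimum by \<open>n\<close>. Conversely,
  positivity at \<open>n\<close> spreads to all of (0, n], so n \<le> \<open>alpha0\<close>, and the
  premise on the boundary excludes equality.\<close>

lemma less_alpha0_iff:
  assumes n: "1 \<le> n" and boundary: "ereal (real n) = alpha0 b0 c0 K0 \<longrightarrow> \<Phi> (real n) \<le> 0"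
  shows "(\<forall>k\<in>{1..n}. 0 < \<Phi> (real k)) \<longleftrightarrow> ereal (real n) < alpha0 b0 c0 K0"
proof
  assume "ereal (real n) < alpha0 b0 c0 K0"
  then show "\<forall>k\<in>{1..n}. 0 < \<Phi> (real k)"
  proof (rule contrapos_pp)
    assume "\<not> (\<forall>k\<in>{1..n}. 0 < \<Phi> (real k))"
    then obtain k where k: "k \<in> {1..n}" "\<Phi> (real k) \<le> 0"
      by (auto simp: not_less)
    then have "alpha0 b0 c0 K0 \<le> ereal (real k)"
      unfolding alpha0_def by (intro Inf_lower) auto
    also have "\<dots> \<le> ereal (real n)"
      using k by simp
    finally show "\<not> ereal (real n) < alpha0 b0 c0 K0"
      by simp
  qed
next
  assume "\<forall>k\<in>{1..n}. 0 < \<Phi> (real k)"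
  then have pos: "0 < \<Phi> (real n)"
    using n by auto
  have "ereal (real n) \<le> alpha0 b0 c0 K0"
    unfolding alpha0_def
  proof (rule Inf_greatest, clarify)
    fix a assume a: "0 < a" "\<Phi> a \<le> 0"
    then show "ereal (real n) \<le> ereal a"
      using laplace_exponent_pos_mono[OF pos, of a] by (cases "a \<le> real n") auto
  qed
  with pos boundary show "ereal (real n) < alpha0 b0 c0 K0"
    by (auto simp: order.strict_iff_order not_le[symmetric])
qed

text \<open>If \<open>X\<close> is nonnegative then \<open>\<Phi> \<ge> 0\<close>, whereas a Gaussian part or negative jumps would make
  \<open>\<Phi>\<close> decrease quadratically.\<close>

lemma nonneg_imp_no_gauss_no_negative_jumps:
  assumes nonneg: "AE \<omega> in M. 0 \<le> X 1 \<omega>"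
  shows "c0 = 0" and "AE x in K0. 0 < x" and "0 < a \<Longrightarrow> 0 \<le> \<Phi> a"
proof -
  show Phi: "0 \<le> \<Phi> a" if "0 < a" for a
  proof -
    have "(\<integral>\<^sup>+\<omega>. ennreal (exp (- a * X 1 \<omega>)) \<partial>M) \<le> (\<integral>\<^sup>+\<omega>. 1 \<partial>M)"
      using nonneg by (intro nn_integral_mono_AE, eventually_elim) (use that in auto)
    then have "(\<integral>\<^sup>+\<omega>. ennreal (exp (- a * X 1 \<omega>)) \<partial>M) \<le> 1"
      by (simp add: emeasure_space_1)
    then show ?thesis
      using nn_integral_exp_eq[OF zero_less_one less_imp_le[OF that]]
      by (cases "\<Phi> a") (auto simp: top_unique)
  qed
  define Q where "Q = (\<integral>\<^sup>+x. ennreal (x\<^sup>2 / 2) * indicator {..<0} x \<partial>K0)"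
  \<comment> \<open>This is \<Phi> a \<ge> 0 divided by the square of \<open>a\<close>: for x < 0
    the integrand of \<Phi> is at least (a x)^2 / 2, and only the drift is linear in
    \<open>a\<close>. Letting \<open>a\<close> tend to infinity makes both terms on the left
    vanish.\<close>
  have key: "ennreal (c0 / 2) + Q \<le> ennreal (b0 / a)" if a: "0 < a" for a
  proof -
    let ?J = "\<integral>\<^sup>+x\<in>- {0}. ennreal (exp (- a * x) - 1 + a * x) \<partial>K0"
    have "ennreal (a\<^sup>2) * Q = (\<integral>\<^sup>+x. ennreal (a\<^sup>2) * (ennreal (x\<^sup>2 / 2) * indicator {..<0} x) \<partial>K0)"
      unfolding Q_def by (intro nn_integral_cmult[symmetric] borel_measurable_K0) measurable
    also have "\<dots> \<le> ?J"
    proof (intro nn_integral_mono)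
      fix x :: real
      have "a\<^sup>2 * (x\<^sup>2 / 2) \<le> exp (- a * x) - 1 + a * x" if "x < 0"
        using exp_lower_Taylor_quadratic[of "- a * x"] a that
        by (simp add: mult_nonneg_nonpos power_mult_distrib)
      then show "ennreal (a\<^sup>2) * (ennreal (x\<^sup>2 / 2) * indicator {..<0} x) \<le>
          ennreal (exp (- a * x) - 1 + a * x) * indicator (- {0}) x"
        by (auto simp: indicator_def ennreal_mult[symmetric] intro!: ennreal_leI)
    qed
    finally have Q_le: "ennreal (a\<^sup>2) * Q \<le> ?J" .
    have "?J \<noteq> \<infinity>"
      using Phi[OF a] by (auto simp: laplace_exponent_def)
    then obtain j where j: "?J = ennreal j" "0 \<le> j"
      by (cases ?J) auto
    have j_le: "j \<le> a * b0 - a\<^sup>2 * c0 / 2"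
      using Phi[OF a] j unfolding laplace_exponent_def by (simp add: enn2ereal_ennreal)
    obtain q where q: "Q = ennreal q" "0 \<le> q"
      using Q_le j a by (cases Q) (auto simp: ennreal_mult_top top_unique)
    have "a\<^sup>2 * q \<le> j"
      using Q_le j q by (simp add: ennreal_mult[symmetric] ennreal_le_iff)
    then have "a * (a * (c0 / 2 + q)) \<le> a * b0"
      using j_le by (simp add: algebra_simps power2_eq_square)
    then have "a * (c0 / 2 + q) \<le> b0"
      using a by (rule mult_left_le_imp_le)
    then have "c0 / 2 + q \<le> b0 / a"
      using a by (simp add: pos_le_divide_eq mult.commute)
    then show ?thesis
      using c0_nonneg q by (simp add: ennreal_plus[symmetric] ennreal_leI del: ennreal_plus)
  qed
  have "(\<lambda>n. ennreal (b0 / real (Suc n))) \<longlonglongrightarrow> ennreal 0"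
    using LIMSEQ_Suc[OF lim_const_over_n[of b0]] by (intro tendsto_ennrealI) simp
  then have "ennreal (c0 / 2) + Q \<le> 0"
    using key by (intro LIMSEQ_le_const[of _ "0::ennreal"]) auto
  then have "c0 / 2 \<le> 0" "Q = 0"
    by (auto simp: ennreal_eq_0_iff)
  then show "c0 = 0"
    using c0_nonneg by simp
  have "AE x in K0. ennreal (x\<^sup>2 / 2) * indicator {..<0} x = 0"
    using \<open>Q = 0\<close> unfolding Q_def
    by (subst nn_integral_0_iff_AE[symmetric]) (auto intro!: borel_measurable_K0)
  moreover have "AE x in K0. x \<noteq> 0"
    using emeasure_K0_zero by (intro AE_I[of _ _ "{0}"]) (auto simp: sets_K0)
  ultimately show "AE x in K0. 0 < x"
    by eventually_elim (auto simp: indicator_def ennreal_eq_0_iff split: if_splits)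
qed

text \<open>The two integrability conditions together make \<open>x\<close> itself integrable, near
  0 and at infinity, so the compensating linear term can be split off into the drift.\<close>

lemma subordinator_laplace_exponent:
  assumes nonneg: "AE \<omega> in M. 0 \<le> X 1 \<omega>"
    and finite_min: "(\<integral>\<^sup>+x\<in>- {0}. ennreal (min \<bar>x\<bar> 1) \<partial>K0) < \<infinity>"
    and a: "0 < a"
  shows "\<Phi> a = ereal (a * (b0 - (LINT x:{0<..}|K0. x)) - (LINT x:{0<..}|K0. (exp (- a * x) - 1)))"
    and "K0 \<noteq> null_measure borel \<Longrightarrow> (LINT x:{0<..}|K0. (exp (- a * x) - 1)) < 0"
proof -
  note c0 = nonneg_imp_no_gauss_no_negative_jumps(1)[OF nonneg]
  note pos = nonneg_imp_no_gauss_no_negative_jumps(2)[OF nonneg]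
  have "(\<integral>\<^sup>+x. ennreal \<bar>x\<bar> \<partial>K0) \<le>
      (\<integral>\<^sup>+x. ennreal (min (x\<^sup>2) \<bar>x\<bar>) * indicator (- {0}) x + ennreal (min \<bar>x\<bar> 1) * indicator (- {0}) x \<partial>K0)"
  proof (intro nn_integral_mono)
    fix x :: real
    have "\<bar>x\<bar> \<le> min (x\<^sup>2) \<bar>x\<bar> + min \<bar>x\<bar> 1"
    proof (cases "1 \<le> \<bar>x\<bar>")
      case True
      then have "\<bar>x\<bar> * 1 \<le> \<bar>x\<bar> * \<bar>x\<bar>"
        by (intro mult_left_mono) auto
      then show ?thesis
        using True by (simp add: min_absorb2 power2_eq_square)
    qed (simp add: min_absorb1)
    then show "ennreal \<bar>x\<bar> \<le> ennreal (min (x\<^sup>2) \<bar>x\<bar>) * indicator (- {0}) x + ennreal (min \<bar>x\<bar> 1) * indicator (- {0}) x"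
      by (auto simp: indicator_def ennreal_plus[symmetric] intro!: ennreal_leI simp del: ennreal_plus)
  qed
  also have "\<dots> = (\<integral>\<^sup>+x\<in>- {0}. ennreal (min (x\<^sup>2) \<bar>x\<bar>) \<partial>K0) + (\<integral>\<^sup>+x\<in>- {0}. ennreal (min \<bar>x\<bar> 1) \<partial>K0)"
    by (intro nn_integral_add borel_measurable_K0) measurable
  also have "\<dots> < \<infinity>"
    using finite_K0 finite_min by simp
  finally have int_x: "integrable K0 (\<lambda>x. x)"
    by (intro integrableI_bounded borel_measurable_K0) auto
  have abs_le: "\<bar>exp (- a * x) - 1\<bar> \<le> a * \<bar>x\<bar>" if "0 < x" for x
    using exp_ge_add_one_self[of "- a * x"] a that by (simp add: abs_if not_less)
  have int1: "integrable K0 (\<lambda>x. indicator {0<..} x *\<^sub>R x)"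
    using int_x by (intro integrable_mult_indicator) (auto simp: sets_K0)
  have int2: "integrable K0 (\<lambda>x. indicator {0<..} x *\<^sub>R (exp (- a * x) - 1))"
  proof (rule Bochner_Integration.integrable_bound)
    show "integrable K0 (\<lambda>x. a * x)"
      using int_x by simp
    show "AE x in K0. norm (indicator {0<..} x *\<^sub>R (exp (- a * x) - 1)) \<le> norm (a * x)"
      using abs_le a by (intro AE_I2) (auto simp: indicator_def abs_mult not_less intro!: mult_nonneg_nonpos)
  qed (intro borel_measurable_K0, measurable)
  let ?J = "\<integral>\<^sup>+x\<in>- {0}. ennreal (exp (- a * x) - 1 + a * x) \<partial>K0"
  let ?I = "(LINT x:{0<..}|K0. (exp (- a * x) - 1)) + a * (LINT x:{0<..}|K0. x)"
  have "?J = (\<integral>\<^sup>+x. ennreal (indicator {0<..} x *\<^sub>R (exp (- a * x) - 1) + a * (indicator {0<..} x *\<^sub>R x)) \<partial>K0)"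
    using pos by (intro nn_integral_cong_AE, eventually_elim) (simp add: indicator_def)
  also have "\<dots> = ennreal (\<integral>x. indicator {0<..} x *\<^sub>R (exp (- a * x) - 1) + a * (indicator {0<..} x *\<^sub>R x) \<partial>K0)"
    using int1 int2 exp_minus_linear_nonneg[of a]
    by (intro nn_integral_eq_integral Bochner_Integration.integrable_add integrable_mult_right AE_I2)
       (auto simp: indicator_def)
  also have "(\<integral>x. indicator {0<..} x *\<^sub>R (exp (- a * x) - 1) + a * (indicator {0<..} x *\<^sub>R x) \<partial>K0) = ?I"
    using int1 int2 by (simp add: set_lebesgue_integral_def)
  finally have J: "?J = ennreal ?I" .
  have I_nonneg: "0 \<le> ?I"
  proof -
    have "?I = (\<integral>x. indicator {0<..} x *\<^sub>R (exp (- a * x) - 1) + a * (indicator {0<..} x *\<^sub>R x) \<partial>K0)"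
      using int1 int2 by (simp add: set_lebesgue_integral_def)
    also have "\<dots> \<ge> 0"
      using exp_minus_linear_nonneg[of a] by (intro integral_nonneg_AE AE_I2) (auto simp: indicator_def)
    finally show ?thesis .
  qed
  show "\<Phi> a = ereal (a * (b0 - (LINT x:{0<..}|K0. x)) - (LINT x:{0<..}|K0. (exp (- a * x) - 1)))"
    unfolding laplace_exponent_def J c0 enn2ereal_ennreal[OF I_nonneg] by (simp add: algebra_simps)
  assume K0: "K0 \<noteq> null_measure borel"
  show "(LINT x:{0<..}|K0. (exp (- a * x) - 1)) < 0"
  proof (rule ccontr)
    let ?f = "\<lambda>x. - (indicator {0<..} x *\<^sub>R (exp (- a * x) - 1))"
    have f: "0 \<le> ?f x" for x
      using a by (auto simp: indicator_def)
    assume "\<not> (LINT x:{0<..}|K0. (exp (- a * x) - 1)) < 0"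
    moreover have "0 \<le> integral\<^sup>L K0 ?f"
      using f by (intro integral_nonneg_AE AE_I2)
    ultimately have "integral\<^sup>L K0 ?f = 0"
      unfolding set_lebesgue_integral_def Bochner_Integration.integral_minus by linarith
    then have "AE x in K0. ?f x = 0"
      using int2 f by (subst integral_nonneg_eq_0_iff_AE[symmetric]) auto
    \<comment> \<open>For x > 0 and a > 0 the number 1 - exp (- a x) is strictly positive, so a
      vanishing integral leaves no mass to \<open>K0\<close>.\<close>
    with pos have "AE x in K0. False"
      by eventually_elim (use a in auto)
    then have "emeasure K0 (space K0) = 0"
      by (simp add: AE_iff_null null_sets_def)
    then have "K0 = null_measure borel"
      by (intro measure_eqI) (auto simp: sets_K0 sets_eq_imp_space_eq[OF sets_K0] intro: emeasure_eq_0[of UNIV])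
    with K0 show False ..
  qed
qed

end

end

(* The premise on n in the first conjunct only excludes the boundary case in which n equals
   alpha0 while the Laplace exponent is still positive at n (and is -infinity beyond n): there
   the n-th moment is finite although n is not less than alpha0. *)
theorem corollary3:
  fixes M :: "'a measure" and X :: "real \<Rightarrow> 'a \<Rightarrow> real"
    and b0 c0 :: real and K0 :: "real measure"
  assumes "levy_process_with_parameters M X b0 c0 K0"
    and "(\<integral>\<^sup>+x\<in>- {0}. ennreal (min (x\<^sup>2) \<bar>x\<bar>) \<partial>K0) < \<infinity>"
  shows
    "(\<forall>n::nat. 1 \<le> n \<longrightarrow>
        (ereal (real n) = alpha0 b0 c0 K0 \<longrightarrow> laplace_exponent b0 c0 K0 (real n) \<le> 0) \<longrightarrow>
        (exp_functional_moment M X n < \<infinity> \<longleftrightarrow> ereal (real n) < alpha0 b0 c0 K0)) \<and>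
     (K0 = null_measure borel \<and> c0 \<noteq> 0 \<longrightarrow>
        (\<forall>n::nat. 1 \<le> n \<longrightarrow>
           laplace_exponent b0 c0 K0 (real n) = ereal (real n * b0 - (real n)\<^sup>2 * c0 / 2) \<and>
           (real n < 2 * b0 / c0 \<longrightarrow> exp_functional_moment M X n < \<infinity>))) \<and>
     (subordinator M X \<and> K0 \<noteq> null_measure borel \<and>
        (\<integral>\<^sup>+x\<in>- {0}. ennreal (min \<bar>x\<bar> 1) \<partial>K0) < \<infinity> \<longrightarrow>
        (\<forall>n::nat. 1 \<le> n \<longrightarrow>
           laplace_exponent b0 c0 K0 (real n) =
             ereal (real n * (b0 - (LINT x:{0<..}|K0. x)) -
                    (LINT x:{0<..}|K0. (exp (- real n * x) - 1)))) \<and>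
        (0 \<le> b0 - (LINT x:{0<..}|K0. x) \<longrightarrow>
           (\<forall>n::nat. 1 \<le> n \<longrightarrow> exp_functional_moment M X n < \<infinity>)))"
proof -
  interpret levy_process_with_parameters M X b0 c0 K0 by fact
  note moment_iff = exp_functional_moment_finite_iff[OF assms(2)]
  show ?thesis
  proof (intro conjI impI allI; (elim conjE)?)
    fix n :: nat
    assume "1 \<le> n" "ereal (real n) = alpha0 b0 c0 K0 \<longrightarrow> laplace_exponent b0 c0 K0 (real n) \<le> 0"
    then show "exp_functional_moment M X n < \<infinity> \<longleftrightarrow> ereal (real n) < alpha0 b0 c0 K0"
      unfolding moment_iff by (rule less_alpha0_iff[OF assms(2)])
  next
    fix n :: nat
    assume K0: "K0 = null_measure borel" and c0: "c0 \<noteq> 0"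
    have Phi: "laplace_exponent b0 c0 K0 a = ereal (a * b0 - a\<^sup>2 * c0 / 2)" for a
      by (simp add: laplace_exponent_def K0 zero_ennreal.rep_eq)
    then show "laplace_exponent b0 c0 K0 (real n) = ereal (real n * b0 - (real n)\<^sup>2 * c0 / 2)" .
    assume n: "real n < 2 * b0 / c0"
    have "0 < real k * b0 - (real k)\<^sup>2 * c0 / 2" if "k \<in> {1..n}" for k
    proof -
      have "real k < 2 * b0 / c0"
        using n that by (intro le_less_trans[OF _ n]) auto
      then have "real k * c0 < 2 * b0"
        using c0 c0_nonneg by (simp add: field_simps)
      then have "0 < real k * (b0 - real k * c0 / 2)"
        using that by (intro mult_pos_pos) auto
      then show ?thesis
        by (simp add: algebra_simps power2_eq_square)
    qed
    then show "exp_functional_moment M X n < \<infinity>"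
      unfolding moment_iff Phi by simp
  next
    assume "subordinator M X" and K0: "K0 \<noteq> null_measure borel"
      and fin: "(\<integral>\<^sup>+x\<in>- {0}. ennreal (min \<bar>x\<bar> 1) \<partial>K0) < \<infinity>"
    then have "AE \<omega> in M. mono_on {0..} (\<lambda>t. X t \<omega>)"
      by (simp add: subordinator_def)
    with starts_at_0 have nonneg: "AE \<omega> in M. 0 \<le> X 1 \<omega>"
    proof eventually_elim
      fix \<omega> assume "X 0 \<omega> = 0" "mono_on {0..} (\<lambda>t. X t \<omega>)"
      then show "0 \<le> X 1 \<omega>"
        using mono_onD[of "{0..}" "\<lambda>t. X t \<omega>" 0 1] by simp
    qed
    note Phi = subordinator_laplace_exponent[OF assms(2) nonneg fin]
    show "laplace_exponent b0 c0 K0 (real n) =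
        ereal (real n * (b0 - (LINT x:{0<..}|K0. x)) - (LINT x:{0<..}|K0. (exp (- real n * x) - 1)))"
      if "1 \<le> n" for n :: nat
      using that by (intro Phi(1)) simp
    assume drift: "0 \<le> b0 - (LINT x:{0<..}|K0. x)"
    show "exp_functional_moment M X n < \<infinity>" for n :: nat
      unfolding moment_iff
    proof
      \<comment> \<open>The drift term is nonnegative and the jump term strictly positive, which
        gives positivity even for zero net drift.\<close>
      fix k assume "k \<in> {1..n}"
      then have k: "0 < real k" by simp
      show "0 < laplace_exponent b0 c0 K0 (real k)"
        unfolding Phi(1)[OF k] using Phi(2)[OF k K0] mult_nonneg_nonneg[OF less_imp_le[OF k] drift] by simp
    qed
  qed
qed

end
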